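(* Let $r>0$ be an integer and let $$G_{1,r}=\langle x,y \,\|\, x^{-r}y^{-1}xyx^{r}=y^{-2}x^{r}yxy^{-1}x^{-r}y^{2}\rangle.$$ Then the first five terms $\gamma_1G_{1,r},\dots,\gamma_5G_{1,r}$ of the lower central series of $G_{1,r}$ are pairwise different. Moreover, $$G_{1,r}/\gamma_4G_{1,r}\cong F_2/\gamma_4F_2,\qquad \gamma_4G_{1,r}/\gamma_5G_{1,r}\cong\mathbb{Z}\times\mathbb{Z}\times\mathbb{Z}_r .$$
   Context: $\langle X\,\|\,R\rangle$ denotes the group with generators $X$ and defining relations $R$; $F_2$ is the free group of rank 2; $\mathbb{Z}_r$ is the cyclic group of order $r$; $\gamma_1G=G$ and $\gamma_{k+1}G=[\gamma_kG,G]$ are the terms of the lower central series of a group $G$. *)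

theory Defs
  imports "HOL-Algebra.Elementary_Groups"
begin

section \<open>Free groups\<close>

text \<open>
  The letter \<open>(x, True)\<close> stands for the generator \<open>x\<close> and \<open>(x, False)\<close> for its formal inverse.
  The free group on \<open>S\<close> consists of the freely reduced words over \<open>S\<close>; the product of two
  reduced words is the free reduction of their concatenation.
\<close>

type_synonym 'a letter = "'a \<times> bool"
type_synonym 'a word = "'a letter list"

definition inv_letter :: "'a letter \<Rightarrow> 'a letter" where
  "inv_letter a = (fst a, \<not> snd a)"

definition reduced_word :: "'a word \<Rightarrow> bool" where
  "reduced_word w \<longleftrightarrow> successively (\<lambda>a b. b \<noteq> inv_letter a) w"

fun push_letter :: "'a letter \<Rightarrow> 'a word \<Rightarrow> 'a word" where
  "push_letter a [] = [a]"
| "push_letter a (b # w) = (if b = inv_letter a then w else a # b # w)"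

definition free_group :: "'a set \<Rightarrow> 'a word monoid" where
  "free_group S =
    \<lparr>carrier = {w. reduced_word w \<and> fst ` set w \<subseteq> S},
     mult = (\<lambda>u v. foldr push_letter u v),
     one = []\<rparr>"

definition free_gen :: "'a \<Rightarrow> 'a word" where
  "free_gen x = [(x, True)]"

lemma inv_letter_inv_letter [simp]: "inv_letter (inv_letter a) = a"
  by (simp add: inv_letter_def)

lemma inv_letter_neq [simp]: "inv_letter a \<noteq> a" "a \<noteq> inv_letter a"
  by (auto simp: inv_letter_def prod_eq_iff)

lemma fst_inv_letter [simp]: "fst (inv_letter a) = fst a"
  by (simp add: inv_letter_def)

lemma reduced_word_Nil [simp]: "reduced_word []"
  by (simp add: reduced_word_def)

lemma reduced_word_ConsD: "reduced_word (a # w) \<Longrightarrow> reduced_word w"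
  by (cases w) (auto simp: reduced_word_def)

lemma push_letter_Cons: "reduced_word (a # w) \<Longrightarrow> push_letter a w = a # w"
  by (cases w) (auto simp: reduced_word_def)

lemma reduced_push_letter: "reduced_word w \<Longrightarrow> reduced_word (push_letter a w)"
  by (cases w; cases "tl w") (auto simp: reduced_word_def)

lemma set_push_letter: "set (push_letter a w) \<subseteq> insert a (set w)"
  by (cases w) auto

lemma push_inv_letter: "reduced_word w \<Longrightarrow> push_letter (inv_letter a) (push_letter a w) = w"
  by (cases w; cases "tl w") (auto simp: reduced_word_def)

lemma reduced_foldr_push: "reduced_word v \<Longrightarrow> reduced_word (foldr push_letter u v)"
  by (induction u) (auto intro: reduced_push_letter)

lemma set_foldr_push: "set (foldr push_letter u v) \<subseteq> set u \<union> set v"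
  by (induction u) (use set_push_letter in fastforce)+

lemma foldr_push_Nil: "reduced_word u \<Longrightarrow> foldr push_letter u [] = u"
proof (induction u)
  case (Cons a u)
  then show ?case using reduced_word_ConsD[of a u] push_letter_Cons[of a u] by simp
qed simp

lemma foldr_push_push:
  assumes "reduced_word w"
  shows "foldr push_letter (push_letter a t) w = push_letter a (foldr push_letter t w)"
proof (cases t)
  case (Cons b t')
  then show ?thesis
    using push_inv_letter[OF reduced_foldr_push[OF assms], of "inv_letter a" t'] by auto
qed auto

lemma foldr_push_assoc:
  assumes "reduced_word w"
  shows "foldr push_letter (foldr push_letter u v) w = foldr push_letter u (foldr push_letter v w)"
  by (induction u) (auto simp: foldr_push_push[OF assms])

lemma reduced_word_append_singleton:
  "reduced_word (u @ [a]) \<longleftrightarrow> reduced_word u \<and> (u = [] \<or> a \<noteq> inv_letter (last u))"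
  by (auto simp: reduced_word_def successively_append_iff)

lemma reduced_word_inverse: "reduced_word u \<Longrightarrow> reduced_word (rev (map inv_letter u))"
proof (induction u)
  case (Cons a u)
  then show ?case
    by (cases u) (auto simp: reduced_word_append_singleton reduced_word_def successively_append_iff
      simp del: append_assoc)
qed auto

lemma foldr_push_inverse:
  "reduced_word v \<Longrightarrow> foldr push_letter (rev (map inv_letter u)) (foldr push_letter u v) = v"
  by (induction u) (auto simp: push_inv_letter reduced_foldr_push)

lemma group_free_group: "group (free_group S)"
proof (rule groupI)
  fix u v assume "u \<in> carrier (free_group S)" "v \<in> carrier (free_group S)"
  then show "u \<otimes>\<^bsub>free_group S\<^esub> v \<in> carrier (free_group S)"
    using set_foldr_push[of u v] by (fastforce simp: free_group_def reduced_foldr_push)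
next
  fix u assume u: "u \<in> carrier (free_group S)"
  then have "rev (map inv_letter u) \<in> carrier (free_group S)"
    by (auto simp: free_group_def reduced_word_inverse image_image)
  moreover have "rev (map inv_letter u) \<otimes>\<^bsub>free_group S\<^esub> u = \<one>\<^bsub>free_group S\<^esub>"
    using u foldr_push_inverse[of "[]" u] by (simp add: free_group_def foldr_push_Nil)
  ultimately show "\<exists>v\<in>carrier (free_group S). v \<otimes>\<^bsub>free_group S\<^esub> u = \<one>\<^bsub>free_group S\<^esub>"
    by blast
qed (auto simp: free_group_def foldr_push_assoc)

text \<open>The universal property of the free group.\<close>

lemma free_gen_carrier: "x \<in> S \<Longrightarrow> free_gen x \<in> carrier (free_group S)"
  by (simp add: free_group_def free_gen_def reduced_word_def)

definition free_lift :: "('b, 'c) monoid_scheme \<Rightarrow> ('a \<Rightarrow> 'b) \<Rightarrow> 'a word \<Rightarrow> 'b" where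
  "free_lift H f w =
     foldr (\<lambda>a h. (if snd a then f (fst a) else inv\<^bsub>H\<^esub> (f (fst a))) \<otimes>\<^bsub>H\<^esub> h) w \<one>\<^bsub>H\<^esub>"

lemma (in group) free_lift_hom:
  assumes f: "f \<in> S \<rightarrow> carrier G"
  shows "free_lift G f \<in> hom (free_group S) G"
proof -
  define e where "e a = (if snd a then f (fst a) else inv (f (fst a)))" for a
  have L: "free_lift G f [] = \<one>" "free_lift G f (a # w) = e a \<otimes> free_lift G f w" for a w
    by (simp_all add: free_lift_def e_def)
  have e: "e a \<in> carrier G" if "fst a \<in> S" for a
    using f that by (auto simp: e_def Pi_iff)
  have c: "free_lift G f w \<in> carrier G" if "fst ` set w \<subseteq> S" for w
    using that by (induction w) (auto simp: L e)
  have inve: "e a \<otimes> (e (inv_letter a) \<otimes> h) = h" if "fst a \<in> S" "h \<in> carrier G" for a h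
    using f that by (auto simp: e_def inv_letter_def Pi_iff m_assoc[symmetric])
  have p: "free_lift G f (push_letter a w) = e a \<otimes> free_lift G f w"
    if "fst a \<in> S" "fst ` set w \<subseteq> S" for a w
    using that by (cases w) (auto simp: L inve c)
  have "free_lift G f (foldr push_letter u v) = free_lift G f u \<otimes> free_lift G f v"
    if "fst ` set u \<subseteq> S" "fst ` set v \<subseteq> S" for u v
    using that
  proof (induction u)
    case (Cons a u)
    have "fst ` set (foldr push_letter u v) \<subseteq> S"
      using Cons.prems by (intro order.trans[OF image_mono[OF set_foldr_push]]) (simp add: image_Un)
    then show ?case using Cons by (auto simp: L p c e m_assoc)
  qed (auto simp: L c)
  then show ?thesis
    by (intro homI) (auto simp: free_group_def c)
qed

lemma (in group) free_lift_gen: "f x \<in> carrier G \<Longrightarrow> free_lift G f (free_gen x) = f x"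
  by (simp add: free_lift_def free_gen_def)

lemma generate_free_gen: "generate (free_group S) (free_gen ` S) = carrier (free_group S)"
proof
  interpret F: group "free_group S" by (rule group_free_group)
  show "generate (free_group S) (free_gen ` S) \<subseteq> carrier (free_group S)"
    by (rule F.generate_incl) (auto intro: free_gen_carrier)
  have letter: "[a] \<in> generate (free_group S) (free_gen ` S)" if a: "fst a \<in> S" for a
  proof (cases "snd a")
    case True
    then show ?thesis using a generate.incl[of "free_gen (fst a)" "free_gen ` S"]
      by (auto simp: free_gen_def prod_eq_iff intro!: generate.incl image_eqI[of _ _ "fst a"])
  next
    case False
    have ac: "[a] \<in> carrier (free_group S)"
      using a by (simp add: free_group_def reduced_word_def)
    have "[a] \<otimes>\<^bsub>free_group S\<^esub> free_gen (fst a) = \<one>\<^bsub>free_group S\<^esub>"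
      using False by (simp add: free_group_def free_gen_def inv_letter_def)
    then have "[a] = inv\<^bsub>free_group S\<^esub> (free_gen (fst a))"
      using F.inv_equality[OF _ free_gen_carrier[OF a] ac] by simp
    then show ?thesis using a by (auto intro: generate.inv)
  qed
  show "carrier (free_group S) \<subseteq> generate (free_group S) (free_gen ` S)"
  proof
    fix w assume "w \<in> carrier (free_group S)"
    then have "reduced_word w" "fst ` set w \<subseteq> S" by (auto simp: free_group_def)
    then show "w \<in> generate (free_group S) (free_gen ` S)"
    proof (induction w)
      case Nil
      show ?case using generate.one[of "free_group S"] by (simp add: free_group_def)
    next
      case (Cons a w)
      have "a # w = [a] \<otimes>\<^bsub>free_group S\<^esub> w"
        using Cons.prems by (simp add: free_group_def push_letter_Cons)
      also have "\<dots> \<in> generate (free_group S) (free_gen ` S)"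
        using Cons by (intro generate.eng letter) (auto dest: reduced_word_ConsD)
      finally show ?case .
    qed
  qed
qed


section \<open>Presentations\<close>

definition normal_closure :: "('a, 'b) monoid_scheme \<Rightarrow> 'a set \<Rightarrow> 'a set" where
  "normal_closure G S =
     generate G {g \<otimes>\<^bsub>G\<^esub> s \<otimes>\<^bsub>G\<^esub> inv\<^bsub>G\<^esub> g | g s. g \<in> carrier G \<and> s \<in> S}"

text \<open>A defining relation \<open>u = v\<close> is given as the pair \<open>(u, v)\<close> of elements of the free group.\<close>

definition presented_group :: "'a set \<Rightarrow> ('a word \<times> 'a word) set \<Rightarrow> 'a word set monoid" where
  "presented_group S R =
     free_group S Mod
       normal_closure (free_group S) {u \<otimes>\<^bsub>free_group S\<^esub> inv\<^bsub>free_group S\<^esub> v | u v. (u, v) \<in> R}"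

lemma (in group) normal_closure_normal:
  assumes S: "S \<subseteq> carrier G"
  shows "normal_closure G S \<lhd> G"
  unfolding normal_closure_def
proof (rule normal_generateI)
  fix h g assume "h \<in> {g \<otimes> s \<otimes> inv g | g s. g \<in> carrier G \<and> s \<in> S}" and g: "g \<in> carrier G"
  then obtain k s where h: "h = k \<otimes> s \<otimes> inv k" "k \<in> carrier G" "s \<in> S" by blast
  then have "g \<otimes> h \<otimes> inv g = (g \<otimes> k) \<otimes> s \<otimes> inv (g \<otimes> k)"
    using g S by (auto simp: m_assoc inv_mult_group subset_iff)
  then show "g \<otimes> h \<otimes> inv g \<in> {g \<otimes> s \<otimes> inv g | g s. g \<in> carrier G \<and> s \<in> S}"
    using g h by blast
qed (use S in auto)

lemma group_presented_group:
  assumes "R \<subseteq> carrier (free_group S) \<times> carrier (free_group S)"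
  shows "group (presented_group S R)"
proof -
  interpret F: group "free_group S" by (rule group_free_group)
  show ?thesis unfolding presented_group_def
    by (intro normal.factorgroup_is_group F.normal_closure_normal) (use assms in auto)
qed


section \<open>The lower central series\<close>

definition commutator_subgroup :: "('a, 'b) monoid_scheme \<Rightarrow> 'a set \<Rightarrow> 'a set \<Rightarrow> 'a set" where
  "commutator_subgroup G H K =
     generate G {h \<otimes>\<^bsub>G\<^esub> k \<otimes>\<^bsub>G\<^esub> inv\<^bsub>G\<^esub> h \<otimes>\<^bsub>G\<^esub> inv\<^bsub>G\<^esub> k | h k. h \<in> H \<and> k \<in> K}"

text \<open>Indexing starts at \<open>1\<close>, i.e. the first term is the whole group; the value at \<open>0\<close> is junk.\<close>

fun lower_central :: "('a, 'b) monoid_scheme \<Rightarrow> nat \<Rightarrow> 'a set" where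
  "lower_central G 0 = carrier G"
| "lower_central G (Suc 0) = carrier G"
| "lower_central G (Suc (Suc k)) = commutator_subgroup G (lower_central G (Suc k)) (carrier G)"


section \<open>The groups of the theorem\<close>

datatype gen2 = Gen_x | Gen_y

abbreviation F2 :: "gen2 word monoid" where
  "F2 \<equiv> free_group UNIV"

definition G1_lhs :: "nat \<Rightarrow> gen2 word" where
  "G1_lhs r = (let x = free_gen Gen_x; y = free_gen Gen_y in
     x [^]\<^bsub>F2\<^esub> (- int r) \<otimes>\<^bsub>F2\<^esub> inv\<^bsub>F2\<^esub> y \<otimes>\<^bsub>F2\<^esub> x \<otimes>\<^bsub>F2\<^esub> y \<otimes>\<^bsub>F2\<^esub> x [^]\<^bsub>F2\<^esub> int r)"

definition G1_rhs :: "nat \<Rightarrow> gen2 word" where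
  "G1_rhs r = (let x = free_gen Gen_x; y = free_gen Gen_y in
     y [^]\<^bsub>F2\<^esub> (- 2 :: int) \<otimes>\<^bsub>F2\<^esub> x [^]\<^bsub>F2\<^esub> int r \<otimes>\<^bsub>F2\<^esub> y \<otimes>\<^bsub>F2\<^esub> x \<otimes>\<^bsub>F2\<^esub> inv\<^bsub>F2\<^esub> y
       \<otimes>\<^bsub>F2\<^esub> x [^]\<^bsub>F2\<^esub> (- int r) \<otimes>\<^bsub>F2\<^esub> y [^]\<^bsub>F2\<^esub> (2 :: int))"

definition G1 :: "nat \<Rightarrow> gen2 word set monoid" where
  "G1 r = presented_group UNIV {(G1_lhs r, G1_rhs r)}"

end

theory Submission
  imports Defs "HOL-Computational_Algebra.Formal_Power_Series"
begin

text \<open>Let \<open>F\<^sub>2\<close> act on the affine line over \<open>\<int>[[X, Y]]\<close> by \<open>x: t \<mapsto> (1 + X) t\<close> and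
  \<open>y: t \<mapsto> (1 + Y) t + 1\<close>. Then \<open>[x, y]\<close> is the translation by \<open>X\<close>, and taking the
  commutator of the translation by \<open>p\<close> with \<open>x\<close> or \<open>y\<close> multiplies \<open>p\<close> by \<open>-X\<close> or \<open>-Y\<close>.
  So \<open>\<gamma>\<^sub>n\<close> acts by translations of order at least \<open>n - 1\<close>, and for \<open>2 \<le> n \<le> 4\<close> the
  leading form identifies \<open>\<gamma>\<^sub>n/\<gamma>\<^sub>n\<^sub>+\<^sub>1\<close> with \<open>X\<close> times the forms of degree \<open>n - 2\<close>.
  The relator lies in \<open>\<gamma>\<^sub>4\<close> with leading form \<open>X \<cdot> rX \<cdot> (rX - Y)\<close>, that is \<open>r\<close> times a
  primitive vector of \<open>\<gamma>\<^sub>4/\<gamma>\<^sub>5 \<cong> \<int>\<^sup>3\<close>.\<close>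

section \<open>The lower central series\<close>

text \<open>The affine group is metabelian, so the action is blind to [gamma_2, gamma_2]. For two
  generators this costs nothing up to weight 4: gamma_2 is cyclic modulo gamma_3, hence
  [gamma_2, gamma_2] lies in gamma_5. In weight 5 the method would fail, since the free quotient has
  rank 6 while there are only four products of \<open>X\<close> with a cubic monomial. Each quotient
  is squeezed from two sides. Commutator calculus bounds the number of generators by 1, 2 and 3;
  independence of the leading forms excludes relations among them. The delicate bound is the last:
  with c = [x, y], the four commutators [c,x,x], [c,x,y], [c,y,x], [c,y,y] arise, and the middle two
  must be identified modulo gamma_5. Let R be the normal closure of the relator. As R lies in
  gamma_4, the last quotient of the theorem is gamma_4/(gamma_5 R). Conjugation is trivial on
  gamma_4/gamma_5, so R contributes only the multiples of one vector, r (r, -1, 0).\<close>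

definition commutator :: "('a, 'b) monoid_scheme \<Rightarrow> 'a \<Rightarrow> 'a \<Rightarrow> 'a" where
  "commutator G h k = h \<otimes>\<^bsub>G\<^esub> k \<otimes>\<^bsub>G\<^esub> inv\<^bsub>G\<^esub> h \<otimes>\<^bsub>G\<^esub> inv\<^bsub>G\<^esub> k"

context group
begin

lemma inv_cancel_left [simp]:
  assumes "a \<in> carrier G" "b \<in> carrier G"
  shows "a \<otimes> (inv a \<otimes> b) = b" "inv a \<otimes> (a \<otimes> b) = b"
  using assms by (simp_all add: m_assoc[symmetric])

lemmas word_simps = m_assoc inv_mult_group commutator_def

lemma commutator_closed [simp]:
  "h \<in> carrier G \<Longrightarrow> k \<in> carrier G \<Longrightarrow> commutator G h k \<in> carrier G"
  by (simp add: commutator_def)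

lemma normal_conj_mem:
  assumes "N \<lhd> G" "n \<in> N" "g \<in> carrier G"
  shows "g \<otimes> n \<otimes> inv g \<in> N"
  using assms by (simp add: normal_inv_iff)

lemma lower_central_Suc:
  "1 \<le> n \<Longrightarrow> lower_central G (Suc n) =
    generate G {commutator G h k | h k. h \<in> lower_central G n \<and> k \<in> carrier G}"
  by (cases n) (simp_all add: commutator_subgroup_def commutator_def)

lemma lower_central_normal: "lower_central G n \<lhd> G"
proof (induction n)
  case 0
  show ?case by (simp add: normal_inv_iff subgroup_self)
next
  case (Suc n)
  show ?case
  proof (cases "n = 0")
    case True
    then show ?thesis by (simp add: normal_inv_iff subgroup_self)
  next
    case False
    have sub: "lower_central G n \<subseteq> carrier G"
      using Suc by (simp add: normal_imp_subgroup subgroup.subset)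
    have "generate G {commutator G h k | h k. h \<in> lower_central G n \<and> k \<in> carrier G} \<lhd> G"
    proof (rule normal_generateI)
      fix c g
      assume "c \<in> {commutator G h k | h k. h \<in> lower_central G n \<and> k \<in> carrier G}"
        and g: "g \<in> carrier G"
      then obtain h k where c: "c = commutator G h k" "h \<in> lower_central G n" "k \<in> carrier G"
        by blast
      have h: "h \<in> carrier G" using c sub by blast
      have "g \<otimes> c \<otimes> inv g = commutator G (g \<otimes> h \<otimes> inv g) (g \<otimes> k \<otimes> inv g)"
        using g c h by (simp add: word_simps)
      moreover have "g \<otimes> h \<otimes> inv g \<in> lower_central G n"
        using normal_conj_mem[OF Suc] c g by blast
      ultimately show "g \<otimes> c \<otimes> inv g
          \<in> {commutator G h k | h k. h \<in> lower_central G n \<and> k \<in> carrier G}"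
        using c g by blast
    qed (use sub in auto)
    then show ?thesis using False by (simp add: lower_central_Suc)
  qed
qed

lemma lower_central_subgroup: "subgroup (lower_central G n) G"
  by (simp add: lower_central_normal normal_imp_subgroup)

lemma lower_central_carrier: "g \<in> lower_central G n \<Longrightarrow> g \<in> carrier G"
  using lower_central_subgroup subgroup.mem_carrier by metis

lemma commutator_lower_central:
  "1 \<le> n \<Longrightarrow> h \<in> lower_central G n \<Longrightarrow> k \<in> carrier G \<Longrightarrow>
    commutator G h k \<in> lower_central G (Suc n)"
  by (auto simp: lower_central_Suc intro: generate.incl)

lemma commutator_mem_normal:
  assumes N: "N \<lhd> G" and h: "h \<in> N" and k: "k \<in> carrier G"
  shows "commutator G h k \<in> N"
proof -
  interpret normal N G by fact
  have "commutator G h k = h \<otimes> (k \<otimes> inv h \<otimes> inv k)"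
    using h k by (simp add: word_simps)
  then show ?thesis using h k N by (simp add: normal_conj_mem)
qed

lemma lower_central_Suc_subset: "lower_central G (Suc n) \<subseteq> lower_central G n"
proof (cases "n = 0")
  case False
  then have "lower_central G (Suc n) =
      generate G {commutator G h k | h k. h \<in> lower_central G n \<and> k \<in> carrier G}"
    by (simp add: lower_central_Suc)
  also have "\<dots> \<subseteq> lower_central G n"
    by (intro generate_subgroup_incl lower_central_subgroup)
       (auto intro: commutator_mem_normal lower_central_normal)
  finally show ?thesis .
qed simp

lemma lower_central_antimono: "m \<le> n \<Longrightarrow> lower_central G n \<subseteq> lower_central G m"
  by (rule lift_Suc_antimono_le[of "lower_central G"]) (rule lower_central_Suc_subset)

text \<open>The quotient gamma_n/gamma_(n+1) is central in G/gamma_(n+1), so a conjugate of an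
  element of \<open>H\<close> differs from it by an element of gamma_(n+1), which is again in
  \<open>H\<close>.\<close>

lemma normal_between_lower_central:
  assumes n: "1 \<le> n" and H: "subgroup H G"
    and lo: "lower_central G (Suc n) \<subseteq> H" and hi: "H \<subseteq> lower_central G n"
  shows "H \<lhd> G"
  unfolding normal_inv_iff
proof (intro conjI ballI H)
  interpret subgroup H G by fact
  fix g h assume g: "g \<in> carrier G" and h: "h \<in> H"
  have "inv (commutator G h g) \<in> H"
    using commutator_lower_central[OF n, of h g] g h lo hi by blast
  then have "inv (commutator G h g) \<otimes> h \<in> H" using h by simp
  also have "inv (commutator G h g) \<otimes> h = g \<otimes> h \<otimes> inv g"
    using g h by (simp add: word_simps)
  finally show "g \<otimes> h \<otimes> inv g \<in> H" .
qed

text \<open>Modulo \<open>N\<close> this is the centralizer of \<open>s\<close> in \<open>K\<close>.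
  Having it as a subgroup reduces statements about all commutators with \<open>s\<close> to
  generators.\<close>

lemma subgroup_commutator_left:
  assumes N: "N \<lhd> G" and K: "subgroup K G" and s: "s \<in> carrier G"
  shows "subgroup {h \<in> K. commutator G h s \<in> N} G"
proof -
  interpret N: normal N G by fact
  interpret K: subgroup K G by fact
  show ?thesis
  proof (rule subgroupI)
    show "{h \<in> K. commutator G h s \<in> N} \<noteq> {}"
      using s by (auto simp: commutator_def intro!: exI[of _ \<one>])
  next
    fix a assume a: "a \<in> {h \<in> K. commutator G h s \<in> N}"
    then have "inv a \<otimes> inv (commutator G a s) \<otimes> inv (inv a) \<in> N"
      by (intro normal_conj_mem[OF N]) auto
    also have "inv a \<otimes> inv (commutator G a s) \<otimes> inv (inv a) = commutator G (inv a) s"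
      using a s by (simp add: word_simps)
    finally show "inv a \<in> {h \<in> K. commutator G h s \<in> N}" using a by auto
  next
    fix a b assume a: "a \<in> {h \<in> K. commutator G h s \<in> N}"
      and b: "b \<in> {h \<in> K. commutator G h s \<in> N}"
    then have "a \<otimes> commutator G b s \<otimes> inv a \<otimes> commutator G a s \<in> N"
      by (intro N.m_closed normal_conj_mem[OF N]) auto
    also have "a \<otimes> commutator G b s \<otimes> inv a \<otimes> commutator G a s = commutator G (a \<otimes> b) s"
      using a b s by (simp add: word_simps)
    finally show "a \<otimes> b \<in> {h \<in> K. commutator G h s \<in> N}" using a b by auto
  qed auto
qed

lemma commutator_inverse:
  "h \<in> carrier G \<Longrightarrow> k \<in> carrier G \<Longrightarrow> inv (commutator G h k) = commutator G k h"
  by (simp add: word_simps)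

lemma subgroup_commutator_right:
  assumes N: "N \<lhd> G" and H: "H \<subseteq> carrier G"
  shows "subgroup {s \<in> carrier G. \<forall>h\<in>H. commutator G h s \<in> N} G"
\<comment> \<open>The empty case is separate because an intersection over no sets would be the whole
  type instead of the carrier.\<close>
proof (cases "H = {}")
  case False
  interpret N: normal N G by fact
  have *: "commutator G h s \<in> N \<longleftrightarrow> commutator G s h \<in> N"
    if "h \<in> carrier G" "s \<in> carrier G" for h s
    using that commutator_inverse N.m_inv_closed by metis
  have "{s \<in> carrier G. \<forall>h\<in>H. commutator G h s \<in> N}
      = (\<Inter>h\<in>H. {s \<in> carrier G. commutator G s h \<in> N})"
    using False * H by auto
  also have "subgroup \<dots> G"
    by (rule subgroups_Inter) (use False H N subgroup_commutator_left subgroup_self in auto)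
  finally show ?thesis .
qed (simp add: subgroup_self)

text \<open>The commutator induces a bimultiplicative map on the successive quotients, so generators of a
  term modulo the next one yield such generators of the next term.\<close>

lemma lower_central_Suc_generate:
  assumes n: "1 \<le> n" and S: "S \<subseteq> carrier G" "generate G S = carrier G"
    and A: "A \<subseteq> lower_central G n"
      "lower_central G n \<subseteq> generate G (A \<union> lower_central G (Suc n))"
  shows "lower_central G (Suc n)
    \<subseteq> generate G ({commutator G a s | a s. a \<in> A \<and> s \<in> S} \<union> lower_central G (Suc (Suc n)))"
    (is "_ \<subseteq> generate G ?B")
proof -
  have Acar: "A \<subseteq> carrier G" using A lower_central_carrier by blast
  have Bsub: "?B \<subseteq> lower_central G (Suc n)"
    using A S lower_central_Suc_subset[of "Suc n"] commutator_lower_central[OF n] by blast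
  then have B: "?B \<subseteq> carrier G" using lower_central_carrier by blast
  \<comment> \<open>Normality is what allows both arguments to be reduced to generators: for a
    normal target, the elements whose commutators land in it form a subgroup, on the left for fixed
    \<open>s\<close> and on the right for all \<open>h\<close> at once.\<close>
  have H: "generate G ?B \<lhd> G"
    using n Bsub B lower_central_subgroup
    by (intro normal_between_lower_central[of "Suc n"] generate_is_subgroup generate_subgroup_incl)
       (auto intro: generate.incl)
  then interpret H: normal "generate G ?B" G .
  have gen: "commutator G h s \<in> generate G ?B" if h: "h \<in> lower_central G n" and s: "s \<in> S" for h s
  proof -
    have "generate G (A \<union> lower_central G (Suc n))
        \<subseteq> {h \<in> carrier G. commutator G h s \<in> generate G ?B}"
    proof (rule generate_subgroup_incl)
      show "subgroup {h \<in> carrier G. commutator G h s \<in> generate G ?B} G"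
        by (rule subgroup_commutator_left) (use H subgroup_self s S in auto)
      have "commutator G a s \<in> generate G ?B" if "a \<in> lower_central G (Suc n)" for a
        using that s S commutator_lower_central[of "Suc n" a s] by (auto intro: generate.incl)
      then show "A \<union> lower_central G (Suc n) \<subseteq> {h \<in> carrier G. commutator G h s \<in> generate G ?B}"
        using Acar s lower_central_carrier by (auto intro: generate.incl)
    qed
    then show ?thesis using h A by auto
  qed
  have "generate G S \<subseteq> {s \<in> carrier G. \<forall>h\<in>lower_central G n. commutator G h s \<in> generate G ?B}"
    by (rule generate_subgroup_incl, use gen S in blast)
       (use H lower_central_carrier in \<open>intro subgroup_commutator_right, auto\<close>)
  then have "{commutator G h k | h k. h \<in> lower_central G n \<and> k \<in> carrier G} \<subseteq> generate G ?B"
    using S by auto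
  then show ?thesis
    using generate_subgroup_incl[OF _ H.subgroup_axioms] by (simp only: lower_central_Suc[OF n])
qed

lemma generate_insert_normal:
  assumes N: "N \<lhd> G" and a: "a \<in> carrier G"
  shows "generate G (insert a N) = {a [^] (i::int) \<otimes> n | i n. n \<in> N}" (is "?L = ?R")
proof
  interpret N: normal N G by fact
  have mem: "insert a N \<subseteq> carrier G" using a by auto
  have R: "subgroup ?R G"
  proof (rule subgroupI)
    have "a [^] (0::int) \<otimes> \<one> \<in> ?R" using N.one_closed by blast
    then show "?R \<noteq> {}" by force
    show "?R \<subseteq> carrier G" using a by auto
  next
    fix g assume "g \<in> ?R"
    then obtain i :: int and n where g: "g = a [^] i \<otimes> n" "n \<in> N" by blast
    have "inv g = a [^] (- i) \<otimes> (a [^] i \<otimes> inv n \<otimes> inv (a [^] i))"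
      using g a by (simp add: word_simps int_pow_neg)
    moreover have "a [^] i \<otimes> inv n \<otimes> inv (a [^] i) \<in> N"
      using g a N by (intro normal_conj_mem) auto
    ultimately show "inv g \<in> ?R" by blast
  next
    fix g h assume "g \<in> ?R" "h \<in> ?R"
    then obtain i n j m where g: "g = a [^] (i::int) \<otimes> n" "n \<in> N"
      and h: "h = a [^] (j::int) \<otimes> m" "m \<in> N" by blast
    have "g \<otimes> h = a [^] (i + j) \<otimes> (a [^] (- j) \<otimes> n \<otimes> inv (a [^] (- j)) \<otimes> m)"
      using g h a by (simp add: word_simps int_pow_neg int_pow_mult)
    moreover have "a [^] (- j) \<otimes> n \<otimes> inv (a [^] (- j)) \<otimes> m \<in> N"
      using g h a N by (intro N.m_closed normal_conj_mem) auto
    ultimately show "g \<otimes> h \<in> ?R" by blast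
  qed
  have "insert a N \<subseteq> ?R"
  proof (intro insert_subsetI subsetI)
    show "a \<in> ?R" using a by (intro CollectI exI[of _ 1] exI[of _ \<one>]) (auto simp: int_pow_1)
    show "n \<in> ?R" if "n \<in> N" for n
      using that by (intro CollectI exI[of _ "0::int"] exI[of _ n]) auto
  qed
  then show "?L \<subseteq> ?R" using R by (intro generate_subgroup_incl)
  interpret L: subgroup ?L G using mem by (rule generate_is_subgroup)
  have "a [^] (i::int) \<in> ?L" for i
    by (rule subgroup_int_pow_closed[OF L.subgroup_axioms]) (auto intro: generate.incl)
  then show "?R \<subseteq> ?L" by (auto intro!: L.m_closed intro: generate.incl)
qed

lemma generate_insert_normalE:
  assumes "g \<in> generate G (insert a N)" "N \<lhd> G" "a \<in> carrier G"
  obtains i :: int and n where "n \<in> N" "g = a [^] i \<otimes> n"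
  using assms generate_insert_normal by auto

section \<open>Exchanging the last two entries of a commutator of weight four\<close>

lemma commutator_eq_oneD:
  assumes "a \<in> carrier G" "b \<in> carrier G" "commutator G a b = \<one>"
  shows "a \<otimes> b = b \<otimes> a"
proof -
  have "commutator G a b \<otimes> (b \<otimes> a) = a \<otimes> b" using assms(1,2) by (simp add: word_simps)
  then show ?thesis using assms by simp
qed

text \<open>Conjugation by \<open>p\<close> multiplies \<open>x\<close> and \<open>y\<close> by
  central elements, and central factors cancel in a commutator. With gamma_5 trivial and
  \<open>p\<close> in gamma_3 this gives [gamma_3, [x, y]] = 1 without the three subgroups
  lemma.\<close>

lemma central_commutators_commute:
  assumes c: "p \<in> carrier G" "x \<in> carrier G" "y \<in> carrier G"
    and px: "\<And>g. g \<in> carrier G \<Longrightarrow> commutator G p x \<otimes> g = g \<otimes> commutator G p x"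
    and py: "\<And>g. g \<in> carrier G \<Longrightarrow> commutator G p y \<otimes> g = g \<otimes> commutator G p y"
  shows "p \<otimes> commutator G x y = commutator G x y \<otimes> p"
proof -
  define a b where "a = commutator G p x" and "b = commutator G p y"
  have ab: "a \<in> carrier G" "b \<in> carrier G" using c by (simp_all add: a_def b_def)
  have X: "p \<otimes> x \<otimes> inv p = a \<otimes> x" and Y: "p \<otimes> y \<otimes> inv p = b \<otimes> y"
    using c by (simp_all add: a_def b_def word_simps)
  have "p \<otimes> commutator G x y \<otimes> inv p
      = commutator G (p \<otimes> x \<otimes> inv p) (p \<otimes> y \<otimes> inv p)"
    using c by (simp add: word_simps)
  also have "\<dots> = (a \<otimes> x) \<otimes> (b \<otimes> y) \<otimes> (inv x \<otimes> inv a) \<otimes> (inv y \<otimes> inv b)"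
    unfolding X Y using ab c by (simp add: word_simps)
  also have "\<dots> = x \<otimes> (a \<otimes> b) \<otimes> y \<otimes> inv x \<otimes> inv a \<otimes> inv y \<otimes> inv b"
    using ab c px[of x, folded a_def] by (simp add: m_assoc[symmetric])
  also have "\<dots> = x \<otimes> ((a \<otimes> b) \<otimes> (y \<otimes> inv x)) \<otimes> inv a \<otimes> inv y \<otimes> inv b"
    using ab c by (simp add: m_assoc)
  also have "(a \<otimes> b) \<otimes> (y \<otimes> inv x) = (y \<otimes> inv x) \<otimes> (b \<otimes> a)"
    using ab c px[of "b \<otimes> (y \<otimes> inv x)", folded a_def] py[of "y \<otimes> inv x", folded b_def]
    by (simp add: m_assoc)
  also have "x \<otimes> ((y \<otimes> inv x) \<otimes> (b \<otimes> a)) \<otimes> inv a \<otimes> inv y \<otimes> inv b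
      = x \<otimes> y \<otimes> inv x \<otimes> (b \<otimes> inv y) \<otimes> inv b"
    using ab c by (simp add: m_assoc)
  also have "\<dots> = commutator G x y"
    using ab c py[of "inv y", folded b_def] by (simp add: word_simps)
  finally have "p \<otimes> commutator G x y \<otimes> inv p \<otimes> p = commutator G x y \<otimes> p" by simp
  then show ?thesis using c by (simp add: m_assoc)
qed

text \<open>Conjugating \<open>x y = c y x\<close> by \<open>c\<close> and collecting compares the two commutators.\<close>

lemma commutator_swap_nilpotent:
  assumes x: "x \<in> carrier G" and y: "y \<in> carrier G" and nil: "lower_central G 5 = {\<one>}"
  defines "c \<equiv> commutator G x y"
  shows "commutator G (commutator G c x) y = commutator G (commutator G c y) x"
proof -
  define p q where "p = commutator G c x" and "q = commutator G c y"
  have c: "c \<in> lower_central G 2"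
    using commutator_lower_central[of 1 x y] x y by (simp add: c_def numeral_2_eq_2)
  have p: "p \<in> lower_central G 3" and q: "q \<in> lower_central G 3"
    using commutator_lower_central[of 2 c] x y c by (simp_all add: p_def q_def numeral_3_eq_3)
  have car: "c \<in> carrier G" "p \<in> carrier G" "q \<in> carrier G"
    using c p q lower_central_carrier by blast+
  have central: "z \<otimes> g = g \<otimes> z" if "z \<in> lower_central G 4" "g \<in> carrier G" for z g
    using commutator_lower_central[of 4 z g] that nil lower_central_carrier
    by (intro commutator_eq_oneD) auto
  have mem: "commutator G u v \<in> lower_central G 4" if "u \<in> lower_central G 3" "v \<in> carrier G" for u v
    using commutator_lower_central[of 3 u v] that by simp
  have pc: "p \<otimes> c = c \<otimes> p" and qc: "q \<otimes> c = c \<otimes> q"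
    unfolding c_def using x y car central[OF mem] p q
    by (intro central_commutators_commute; blast)+
  \<comment> \<open>The same lemma again, now with \<open>p\<close> read as the commutator of
    \<open>c\<close> and \<open>x\<close>: the element [q, c] is trivial and [q, x] is
    central.\<close>
  have qp: "q \<otimes> p = p \<otimes> q"
  proof -
    have "commutator G q c = \<one>" using qc car by (simp add: commutator_def inv_solve_right' m_assoc)
    then show ?thesis
      unfolding p_def using x car central[OF mem[OF q x]]
      by (intro central_commutators_commute) simp_all
  qed
  define b d where "b = commutator G p y" and "d = commutator G q x"
  have bd: "b \<in> lower_central G 4" "d \<in> lower_central G 4"
    using mem p q x y by (simp_all add: b_def d_def)
  then have bdc: "b \<in> carrier G" "d \<in> carrier G" using lower_central_carrier by blast+
  have py: "p \<otimes> y = b \<otimes> y \<otimes> p" and qx: "q \<otimes> x = d \<otimes> x \<otimes> q"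
    using car x y by (simp_all add: b_def d_def word_simps)
  have cx: "c \<otimes> x = p \<otimes> x \<otimes> c" and cy: "c \<otimes> y = q \<otimes> y \<otimes> c"
    using car x y by (simp_all add: p_def q_def word_simps)
  have xy: "x \<otimes> y = c \<otimes> y \<otimes> x" using x y by (simp add: c_def word_simps)
  \<comment> \<open>Write W = p x q y and V = p q x y. Since q x = d x q with d central, V = d W;
    multiplied by b this becomes equation \<open>1\<close>.\<close>
  have "(d \<otimes> b) \<otimes> (p \<otimes> x \<otimes> q \<otimes> y) = b \<otimes> (p \<otimes> (d \<otimes> x \<otimes> q) \<otimes> y)"
    using central[OF bd(2), of "b \<otimes> p"] car bdc x y by (simp add: m_assoc[symmetric])
  also have "\<dots> = b \<otimes> (p \<otimes> q \<otimes> x \<otimes> y)"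
    using car bdc x y by (simp add: qx[symmetric] m_assoc)
  finally have 1: "(d \<otimes> b) \<otimes> (p \<otimes> x \<otimes> q \<otimes> y) = b \<otimes> (p \<otimes> q \<otimes> (x \<otimes> y))"
    using car bdc x y by (simp add: m_assoc)
  have "c \<otimes> (x \<otimes> y) = p \<otimes> x \<otimes> (c \<otimes> y)"
    using car x y cx by (simp add: m_assoc[symmetric])
  then have cxy: "c \<otimes> (x \<otimes> y) = p \<otimes> x \<otimes> q \<otimes> y \<otimes> c"
    using car x y cy by (simp add: m_assoc)
  have "c \<otimes> (y \<otimes> x) = q \<otimes> y \<otimes> (c \<otimes> x)"
    using car x y cy by (simp add: m_assoc[symmetric])
  then have cyx: "c \<otimes> (y \<otimes> x) = q \<otimes> y \<otimes> p \<otimes> x \<otimes> c"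
    using car x y cx by (simp add: m_assoc)
  \<comment> \<open>In x y = c y x, multiplied by c on the left, a factor c is pushed to the right
    end through x y on one side and through y x on the other.\<close>
  have "p \<otimes> x \<otimes> q \<otimes> y \<otimes> c = c \<otimes> (q \<otimes> y \<otimes> p \<otimes> x) \<otimes> c"
    using cxy xy cyx car x y by (simp add: m_assoc)
  then have 2: "p \<otimes> x \<otimes> q \<otimes> y = c \<otimes> (q \<otimes> y \<otimes> p \<otimes> x)"
    using car x y by simp
  \<comment> \<open>Absorbing b turns y p into p y. As p, q and c commute, b W = c q p y x = p q (c
    y x) = V, so b and d both carry W to V.\<close>
  have "b \<otimes> (p \<otimes> x \<otimes> q \<otimes> y) = c \<otimes> (q \<otimes> (b \<otimes> y \<otimes> p) \<otimes> x)"
    unfolding 2 using central[OF bd(1), of "c \<otimes> q"] car bdc x y by (simp add: m_assoc[symmetric])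
  also have "\<dots> = c \<otimes> (q \<otimes> p) \<otimes> (y \<otimes> x)"
    using car bdc x y by (simp add: py[symmetric] m_assoc)
  also have "c \<otimes> (q \<otimes> p) = p \<otimes> q \<otimes> c"
    using car qp pc qc by (metis m_assoc)
  also have "p \<otimes> q \<otimes> c \<otimes> (y \<otimes> x) = p \<otimes> q \<otimes> (x \<otimes> y)"
    using car x y xy by (simp add: m_assoc)
  finally have 3: "b \<otimes> (p \<otimes> x \<otimes> q \<otimes> y) = p \<otimes> q \<otimes> (x \<otimes> y)" .
  have "d \<otimes> (p \<otimes> q \<otimes> (x \<otimes> y)) = b \<otimes> (p \<otimes> q \<otimes> (x \<otimes> y))"
    using 1 3 car bdc x y by (simp add: m_assoc)
  then have "d = b" using car bdc x y by simp
  then show ?thesis by (simp add: b_def d_def p_def q_def)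
qed

end

section \<open>Lower central series under homomorphisms and in quotients\<close>

lemma (in group_hom) hom_commutator:
  "a \<in> carrier G \<Longrightarrow> b \<in> carrier G \<Longrightarrow> h (commutator G a b) = commutator H (h a) (h b)"
  by (simp add: commutator_def)

lemma (in group_hom) lower_central_image_subset: "h ` lower_central G n \<subseteq> lower_central H n"
proof (induction n)
  case (Suc n)
  show ?case
  proof (cases "n = 0")
    case False
    have sub: "{commutator G a b | a b. a \<in> lower_central G n \<and> b \<in> carrier G} \<subseteq> carrier G"
      using G.lower_central_carrier by auto
    have "h ` lower_central G (Suc n) =
        generate H (h ` {commutator G a b | a b. a \<in> lower_central G n \<and> b \<in> carrier G})"
      using False generate_img[OF sub] by (simp add: G.lower_central_Suc)
    also have "\<dots> \<subseteq> lower_central H (Suc n)"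
    proof (intro H.generate_subgroup_incl H.lower_central_subgroup subsetI)
      fix u assume "u \<in> h ` {commutator G a b | a b. a \<in> lower_central G n \<and> b \<in> carrier G}"
      then obtain a b where u: "u = h (commutator G a b)" "a \<in> lower_central G n" "b \<in> carrier G"
        by blast
      then have "h a \<in> lower_central H n" using Suc by blast
      then show "u \<in> lower_central H (Suc n)"
        using u False G.lower_central_carrier
        by (simp add: hom_commutator H.commutator_lower_central)
    qed
    finally show ?thesis .
  qed (simp add: image_subset_iff)
qed (simp add: image_subset_iff)

lemma (in group_hom) lower_central_image:
  assumes surj: "h ` carrier G = carrier H"
  shows "h ` lower_central G n = lower_central H n"
proof (induction n)
  case (Suc n)
  show ?case
  proof (cases "n = 0")
    case False
    have sub: "{commutator G a b | a b. a \<in> lower_central G n \<and> b \<in> carrier G} \<subseteq> carrier G"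
      using G.lower_central_carrier by auto
    have "{commutator H a b | a b. a \<in> lower_central H n \<and> b \<in> carrier H}
        \<subseteq> h ` {commutator G a b | a b. a \<in> lower_central G n \<and> b \<in> carrier G}"
    proof
      fix u assume "u \<in> {commutator H a b | a b. a \<in> lower_central H n \<and> b \<in> carrier H}"
      then obtain a b where ab: "u = commutator H (h a) (h b)" "a \<in> lower_central G n" "b \<in> carrier G"
        unfolding Suc[symmetric] surj[symmetric] by blast
      then have "u = h (commutator G a b)" using G.lower_central_carrier by (simp add: hom_commutator)
      then show "u \<in> h ` {commutator G a b | a b. a \<in> lower_central G n \<and> b \<in> carrier G}"
        using ab by blast
    qed
    then have "lower_central H (Suc n) \<subseteq> h ` lower_central G (Suc n)"
      using False generate_img[OF sub, symmetric]
      by (simp add: G.lower_central_Suc H.lower_central_Suc H.mono_generate)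
    then show ?thesis using lower_central_image_subset by blast
  qed (simp add: surj)
qed (simp add: surj)

lemma (in normal) quotient_group_hom: "group_hom G (G Mod H) ((#>) H)"
  by (simp add: group_hom_def group_hom_axioms_def is_group factorgroup_is_group r_coset_hom_Mod)

context group
begin

text \<open>The exact identity holds in G/gamma_5, whose own fifth term is trivial; read in cosets
  it is a congruence modulo gamma_5.\<close>

lemma commutator_swap:
  assumes x: "x \<in> carrier G" and y: "y \<in> carrier G"
  defines "c \<equiv> commutator G x y"
  shows "commutator G (commutator G c y) x \<otimes> inv (commutator G (commutator G c x) y)
    \<in> lower_central G 5"
proof -
  let ?N = "lower_central G 5"
  interpret N: normal ?N G by (rule lower_central_normal)
  interpret Q: group_hom G "G Mod ?N" "(#>) ?N" by (rule N.quotient_group_hom)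
  have one: "?N #> g = \<one>\<^bsub>G Mod ?N\<^esub> \<longleftrightarrow> g \<in> ?N" if "g \<in> carrier G" for g
    using that coset_join1[OF _ that N.subgroup_axioms] coset_join2[OF that N.subgroup_axioms]
    by auto
  have "lower_central (G Mod ?N) 5 = (#>) ?N ` ?N"
    by (rule Q.lower_central_image[symmetric]) (simp add: carrier_FactGroup)
  also have "\<dots> = {\<one>\<^bsub>G Mod ?N\<^esub>}"
    using one lower_central_carrier[of _ 5] N.one_closed by blast
  finally have nil: "lower_central (G Mod ?N) 5 = {\<one>\<^bsub>G Mod ?N\<^esub>}" .
  define u v where "u = commutator G (commutator G c y) x"
    and "v = commutator G (commutator G c x) y"
  have uv: "u \<in> carrier G" "v \<in> carrier G" using x y by (simp_all add: u_def v_def c_def)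
  have "?N #> u = ?N #> v"
    unfolding u_def v_def c_def
    using Q.H.commutator_swap_nilpotent[OF Q.hom_closed[OF x] Q.hom_closed[OF y] nil] x y
    by (simp only: Q.hom_commutator commutator_closed)
  moreover have "?N #> (u \<otimes> inv v) = (?N #> u) \<otimes>\<^bsub>G Mod ?N\<^esub> inv\<^bsub>G Mod ?N\<^esub> (?N #> v)"
    by (simp only: Q.hom_mult Q.hom_inv uv inv_closed)
  ultimately have "?N #> (u \<otimes> inv v) = \<one>\<^bsub>G Mod ?N\<^esub>"
    by (simp only: Q.H.r_inv Q.hom_closed uv)
  then have "u \<otimes> inv v \<in> ?N" using one uv by blast
  then show ?thesis by (simp only: u_def v_def)
qed

section \<open>Generators of the lower central quotients of a two-generator group\<close>

lemma lower_central_2_generators: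
  assumes x: "x \<in> carrier G" and y: "y \<in> carrier G" and gen: "generate G {x, y} = carrier G"
    and g: "g \<in> lower_central G 2"
  obtains i :: int and z where "z \<in> lower_central G 3" "g = commutator G x y [^] i \<otimes> z"
proof -
  let ?c = "commutator G x y"
  have c: "?c \<in> carrier G" using x y by simp
  let ?H = "generate G (insert ?c (lower_central G 3))"
  have H: "subgroup ?H G"
    using c lower_central_carrier by (intro generate_is_subgroup) auto
  have "lower_central G 1 \<subseteq> generate G ({x, y} \<union> lower_central G (Suc 1))"
    using gen mono_generate[of "{x, y}" "{x, y} \<union> lower_central G (Suc 1)"] by simp
  then have "lower_central G (Suc 1) \<subseteq> generate G
      ({commutator G a s | a s. a \<in> {x, y} \<and> s \<in> {x, y}} \<union> lower_central G (Suc (Suc 1)))"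
    using x y gen by (intro lower_central_Suc_generate) simp_all
  also have "\<dots> \<subseteq> ?H"
  proof (rule generate_subgroup_incl[OF _ H])
    \<comment> \<open>Of the four commutators of generators, two are trivial and one is the inverse
      of the remaining one.\<close>
    have "commutator G x x = \<one>" "commutator G y y = \<one>" "commutator G y x = inv ?c"
      using x y by (simp_all add: word_simps)
    moreover have "\<one> \<in> ?H" "?c \<in> ?H" "inv ?c \<in> ?H"
      by (simp_all add: generate.one generate.incl generate.inv)
    ultimately have "commutator G a s \<in> ?H" if "a \<in> {x, y}" "s \<in> {x, y}" for a s
      using that by auto
    moreover have "lower_central G 3 \<subseteq> ?H" by (blast intro: generate.incl)
    ultimately show "{commutator G a s | a s. a \<in> {x, y} \<and> s \<in> {x, y}}
        \<union> lower_central G (Suc (Suc 1)) \<subseteq> ?H"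
      unfolding numeral_3_eq_3 One_nat_def by blast
  qed
  finally have "g \<in> ?H" using g by (simp add: numeral_2_eq_2 subset_iff)
  then show ?thesis by (rule generate_insert_normalE[OF _ lower_central_normal c that])
qed

lemma lower_central_3_generators:
  assumes x: "x \<in> carrier G" and y: "y \<in> carrier G" and gen: "generate G {x, y} = carrier G"
    and g: "g \<in> lower_central G 3"
  defines "c \<equiv> commutator G x y"
  obtains i j :: int and z where "z \<in> lower_central G 4"
    "g = commutator G c x [^] i \<otimes> (commutator G c y [^] j \<otimes> z)"
proof -
  let ?p = "commutator G c x" and ?q = "commutator G c y"
  have c: "c \<in> lower_central G 2"
    using commutator_lower_central[of 1 x y] x y by (simp add: c_def numeral_2_eq_2)
  have pq: "?p \<in> lower_central G 3" "?q \<in> lower_central G 3"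
    using commutator_lower_central[of 2 c] x y c by simp_all
  then have car: "?p \<in> carrier G" "?q \<in> carrier G" using lower_central_carrier by blast+
  \<comment> \<open>The generators are adjoined one at a time. Every intermediate group lies between
    consecutive lower central terms, hence is normal, and so each adjunction splits off one power by
    \<open>generate_insert_normalE\<close>.\<close>
  let ?B = "generate G (insert ?q (lower_central G 4))"
  have B: "subgroup ?B G"
    using car lower_central_carrier by (intro generate_is_subgroup) auto
  have BN: "?B \<lhd> G"
    using pq lower_central_Suc_subset[of 3] lower_central_subgroup[of 3]
    by (intro normal_between_lower_central[of 3] B generate_subgroup_incl)
       (auto intro: generate.incl)
  have "lower_central G 2 \<subseteq> generate G ({c} \<union> lower_central G (Suc 2))"
  proof
    fix g assume "g \<in> lower_central G 2"
    then obtain i :: int and z where "z \<in> lower_central G 3" "g = c [^] i \<otimes> z"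
      using lower_central_2_generators[OF x y gen] c_def by metis
    then have "g \<in> generate G (insert c (lower_central G 3))"
      using generate_insert_normal[OF lower_central_normal lower_central_carrier[OF c], of 3] by auto
    then show "g \<in> generate G ({c} \<union> lower_central G (Suc 2))" by simp
  qed
  then have "lower_central G (Suc 2) \<subseteq> generate G
      ({commutator G a s | a s. a \<in> {c} \<and> s \<in> {x, y}} \<union> lower_central G (Suc (Suc 2)))"
    by (intro lower_central_Suc_generate) (use x y gen c in auto)
  also have "\<dots> \<subseteq> generate G (insert ?p ?B)"
    using car B subgroup.subset[OF B]
    by (intro generate_subgroup_incl generate_is_subgroup) (auto intro!: generate.incl)
  finally have "g \<in> generate G (insert ?p ?B)" using g by auto
  then obtain i :: int and n where n: "n \<in> ?B" "g = ?p [^] i \<otimes> n"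
    using BN car(1) by (rule generate_insert_normalE)
  obtain j :: int and z where "z \<in> lower_central G 4" "n = ?q [^] j \<otimes> z"
    using n(1) lower_central_normal car(2) by (rule generate_insert_normalE)
  then show ?thesis using that n by blast
qed

text \<open>Two generators of weight 3 paired with \<open>x\<close> and \<open>y\<close> give four
  commutators. \<open>commutator_swap\<close> expresses [c, y, x] through [c, x, y] modulo gamma_5,
  which leaves three.\<close>

lemma lower_central_4_generators:
  assumes x: "x \<in> carrier G" and y: "y \<in> carrier G" and gen: "generate G {x, y} = carrier G"
    and g: "g \<in> lower_central G 4"
  defines "c \<equiv> commutator G x y"
  obtains i j k :: int and z where "z \<in> lower_central G 5"
    "g = commutator G (commutator G c x) x [^] i \<otimes> (commutator G (commutator G c x) y [^] j
      \<otimes> (commutator G (commutator G c y) y [^] k \<otimes> z))"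
proof -
  let ?p = "commutator G c x" and ?q = "commutator G c y"
  let ?px = "commutator G ?p x" and ?py = "commutator G ?p y"
    and ?qx = "commutator G ?q x" and ?qy = "commutator G ?q y"
  have c: "c \<in> lower_central G 2"
    using commutator_lower_central[of 1 x y] x y by (simp add: c_def numeral_2_eq_2)
  have pq: "?p \<in> lower_central G 3" "?q \<in> lower_central G 3"
    using commutator_lower_central[of 2 c] x y c by simp_all
  have four: "?px \<in> lower_central G 4" "?py \<in> lower_central G 4"
     "?qx \<in> lower_central G 4" "?qy \<in> lower_central G 4"
    using commutator_lower_central[of 3] x y pq by simp_all
  have car: "?p \<in> carrier G" "?q \<in> carrier G"
    "?px \<in> carrier G" "?py \<in> carrier G" "?qx \<in> carrier G" "?qy \<in> carrier G"
    using four pq lower_central_carrier by blast+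
  let ?B = "generate G (insert ?qy (lower_central G 5))"
  have B: "subgroup ?B G"
    using car lower_central_carrier by (intro generate_is_subgroup) auto
  have B4: "?B \<subseteq> lower_central G 4"
    using four lower_central_Suc_subset[of 4] lower_central_subgroup[of 4]
    by (intro generate_subgroup_incl) auto
  have BN: "?B \<lhd> G"
    by (intro normal_between_lower_central[of 4] B B4) (auto intro: generate.incl)
  let ?C = "generate G (insert ?py ?B)"
  have C: "subgroup ?C G"
    using car subgroup.subset[OF B] by (intro generate_is_subgroup) auto
  have B_le_C: "?B \<subseteq> ?C" by (auto intro: generate.incl)
  have CN: "?C \<lhd> G"
    using four B4 lower_central_subgroup[of 4] B_le_C
    by (intro normal_between_lower_central[of 4] C generate_subgroup_incl)
       (auto intro!: generate.incl)
  let ?D = "generate G (insert ?px ?C)"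
  have D: "subgroup ?D G"
    using car subgroup.subset[OF C] by (intro generate_is_subgroup) auto
  have C_le_D: "?C \<subseteq> ?D" by (auto intro: generate.incl)
  have py: "?py \<in> ?D" using C_le_D by (auto intro: generate.incl)
  have five: "lower_central G 5 \<subseteq> ?D" using B_le_C C_le_D by (auto intro: generate.incl)
  have "?qx \<otimes> inv ?py \<in> ?D"
    using commutator_swap[OF x y] by (intro subsetD[OF five]) (simp only: c_def)
  from subgroup.m_closed[OF D this py] have "?qx \<otimes> inv ?py \<otimes> ?py \<in> ?D" .
  then have qx: "?qx \<in> ?D" using car by (simp add: m_assoc)
  have qy: "?qy \<in> ?D" using C_le_D B_le_C by (auto intro: generate.incl)
  let ?E = "generate G ({?p, ?q} \<union> lower_central G 4)"
  have E: "subgroup ?E G"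
    using car lower_central_carrier[of _ 4] by (intro generate_is_subgroup) blast
  have "lower_central G 3 \<subseteq> ?E"
  proof
    fix g assume "g \<in> lower_central G 3"
    then obtain i j :: int and z where z: "z \<in> lower_central G 4" "g = ?p [^] i \<otimes> (?q [^] j \<otimes> z)"
      using lower_central_3_generators[OF x y gen] c_def by metis
    have "?p \<in> ?E" "?q \<in> ?E" "z \<in> ?E" using z by (auto intro: generate.incl)
    then show "g \<in> ?E"
      unfolding z(2) by (intro subgroup.m_closed[OF E] subgroup_int_pow_closed[OF E])
  qed
  then have "lower_central G (Suc 3) \<subseteq> generate G
      ({commutator G a s | a s. a \<in> {?p, ?q} \<and> s \<in> {x, y}} \<union> lower_central G (Suc (Suc 3)))"
    by (intro lower_central_Suc_generate) (use x y gen pq in auto)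
  also have "\<dots> \<subseteq> ?D"
    using py qx qy five D by (intro generate_subgroup_incl) (auto intro: generate.incl)
  finally have "g \<in> ?D" using g by auto
  then obtain i :: int and n where n: "n \<in> ?C" "g = ?px [^] i \<otimes> n"
    using CN car(3) by (rule generate_insert_normalE)
  obtain j :: int and m where m: "m \<in> ?B" "n = ?py [^] j \<otimes> m"
    using n(1) BN car(4) by (rule generate_insert_normalE)
  obtain k :: int and z where "z \<in> lower_central G 5" "m = ?qy [^] k \<otimes> z"
    using m(1) lower_central_normal car(6) by (rule generate_insert_normalE)
  then show ?thesis using that n m by blast
qed

end

section \<open>Affine maps over the ring of integer power series in two variables\<close>

abbreviation coeff2 :: "'a::zero fps fps \<Rightarrow> nat \<Rightarrow> nat \<Rightarrow> 'a" where
  "coeff2 f i j \<equiv> fps_nth (fps_nth f i) j"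

text \<open>This is membership in the \<open>n\<close>-th power of the ideal generated by the two
  variables, that is, order at least \<open>n\<close> in total degree.\<close>

definition vanishes :: "nat \<Rightarrow> int fps fps \<Rightarrow> bool" where
  "vanishes n f \<longleftrightarrow> (\<forall>i j. i + j < n \<longrightarrow> coeff2 f i j = 0)"

lemma vanishes_0 [simp]: "vanishes 0 f" "vanishes n 0"
  by (simp_all add: vanishes_def)

lemma vanishes_mono: "vanishes n f \<Longrightarrow> m \<le> n \<Longrightarrow> vanishes m f"
  by (simp add: vanishes_def)

lemma vanishes_add: "vanishes n f \<Longrightarrow> vanishes n g \<Longrightarrow> vanishes n (f + g)"
  by (simp add: vanishes_def)

lemma vanishes_diff: "vanishes n f \<Longrightarrow> vanishes n g \<Longrightarrow> vanishes n (f - g)"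
  by (simp add: vanishes_def)

lemma vanishes_uminus_iff [simp]: "vanishes n (- f) \<longleftrightarrow> vanishes n f"
  by (simp add: vanishes_def)

lemma vanishes_mult:
  assumes "vanishes m f" "vanishes n g"
  shows "vanishes (m + n) (f * g)"
  unfolding vanishes_def
proof (intro allI impI)
  fix i j :: nat assume ij: "i + j < m + n"
  have "coeff2 f k l * coeff2 g (i - k) (j - l) = 0" if "k \<le> i" "l \<le> j" for k l
  proof (cases "k + l < m")
    case False
    then have "(i - k) + (j - l) < n" using ij that by linarith
    then show ?thesis using assms by (simp add: vanishes_def)
  qed (use assms in \<open>simp add: vanishes_def\<close>)
  then show "coeff2 (f * g) i j = 0"
    by (auto simp: fps_mult_nth fps_sum_nth intro!: sum.neutral)
qed

lemma vanishes_mult_left: "vanishes n g \<Longrightarrow> vanishes n (f * g)"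
  using vanishes_mult[of 0 f n g] by simp

lemma vanishes_mult_minus_one:
  assumes "vanishes 1 (f - 1)" "vanishes 1 (g - 1)"
  shows "vanishes 1 (f * g - 1)"
proof -
  have "vanishes 1 (f * (g - 1) + (f - 1))"
    using assms by (intro vanishes_add vanishes_mult_left)
  then show ?thesis by (simp add: algebra_simps)
qed

text \<open>The affine maps \<open>t \<mapsto> a t + p\<close> with \<open>a\<close> a unit of constant term \<open>1\<close>.\<close>

definition affine_group :: "(int fps fps \<times> int fps fps) monoid" where
  "affine_group = \<lparr>carrier = {(a, p). a dvd 1 \<and> vanishes 1 (a - 1)},
     monoid.mult = (\<lambda>(a, p) (b, q). (a * b, p + a * q)), one = (1, 0)\<rparr>"

lemma affine_group_simps [simp]:
  "(a, p) \<in> carrier affine_group \<longleftrightarrow> a dvd 1 \<and> vanishes 1 (a - 1)"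
  "(a, p) \<otimes>\<^bsub>affine_group\<^esub> (b, q) = (a * b, p + a * q)"
  "\<one>\<^bsub>affine_group\<^esub> = (1, 0)"
  by (simp_all add: affine_group_def)

lemma vanishes_inverse:
  assumes "vanishes 1 (a - 1)" "a * b = 1"
  shows "vanishes 1 (b - 1)"
proof -
  have "b - 1 = - (b * (a - 1))" using assms by (simp add: algebra_simps)
  then show ?thesis using assms vanishes_mult_left by simp
qed

lemma group_affine_group: "group affine_group"
proof (rule groupI)
  fix g h k assume "g \<in> carrier affine_group" "h \<in> carrier affine_group"
  then show "g \<otimes>\<^bsub>affine_group\<^esub> h \<in> carrier affine_group"
    using mult_dvd_mono[of _ 1 _ 1] vanishes_mult_minus_one by (cases g; cases h) auto
next
  fix g assume "g \<in> carrier affine_group"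
  moreover obtain a p where g: "g = (a, p)" by force
  ultimately obtain b where b: "vanishes 1 (a - 1)" "a * b = 1" by (auto simp: dvd_def)
  then have "(b, - (b * p)) \<in> carrier affine_group"
    using vanishes_inverse[of a b] dvd_triv_right[of b a] by simp
  moreover have "(b, - (b * p)) \<otimes>\<^bsub>affine_group\<^esub> g = \<one>\<^bsub>affine_group\<^esub>"
    using b g by (simp add: mult.commute)
  ultimately show "\<exists>h\<in>carrier affine_group. h \<otimes>\<^bsub>affine_group\<^esub> g = \<one>\<^bsub>affine_group\<^esub>"
    by blast
qed (auto simp: algebra_simps)

interpretation affine: group affine_group by (rule group_affine_group)

lemma affine_inverse:
  assumes "(a, p) \<in> carrier affine_group" "a * b = 1"
  shows "inv\<^bsub>affine_group\<^esub> (a, p) = (b, - (b * p))"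
proof (rule affine.inv_equality)
  have "b dvd 1" using dvd_triv_right[of b a] assms(2) by simp
  then show "(b, - (b * p)) \<in> carrier affine_group"
    using vanishes_inverse[of a b] assms by simp
  show "(b, - (b * p)) \<otimes>\<^bsub>affine_group\<^esub> (a, p) = \<one>\<^bsub>affine_group\<^esub>"
    using assms(2) by (simp add: mult.commute[of b a])
qed (use assms in simp)

lemma (in group) commutator_eqI:
  assumes "a \<in> carrier G" "b \<in> carrier G" "d \<in> carrier G" "d \<otimes> (b \<otimes> a) = a \<otimes> b"
  shows "commutator G a b = d"
proof -
  have "commutator G a b \<otimes> (b \<otimes> a) = d \<otimes> (b \<otimes> a)"
    using assms by (simp add: word_simps)
  then show ?thesis using assms by (metis commutator_closed m_closed right_cancel)
qed

lemma affine_commutator_translation: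
  assumes "(a, q) \<in> carrier affine_group"
  shows "commutator affine_group (1, p) (a, q) = (1, (1 - a) * p)"
  by (rule affine.commutator_eqI) (use assms in \<open>auto simp: algebra_simps\<close>)

text \<open>The linear part \<open>b\<close> does not enter the result, so of a word commutated with
  \<open>x\<close> only the translation part has to be computed.\<close>

lemma affine_commutator_linear:
  assumes "(a, 0) \<in> carrier affine_group" "(b, q) \<in> carrier affine_group"
  shows "commutator affine_group (a, 0) (b, q) = (1, (a - 1) * q)"
  by (rule affine.commutator_eqI) (use assms in \<open>auto simp: algebra_simps\<close>)

text \<open>Because \<open>a\<close> has constant term 1, conjugation changes a translation only in
  terms of higher order and preserves its leading form.\<close>

lemma affine_conj_translation:
  assumes "(a, q) \<in> carrier affine_group"
  shows "(a, q) \<otimes>\<^bsub>affine_group\<^esub> (1, p) \<otimes>\<^bsub>affine_group\<^esub> inv\<^bsub>affine_group\<^esub> (a, q) = (1, a * p)"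
proof -
  from assms obtain b where b: "a * b = 1" by (auto simp: dvd_def)
  show ?thesis using affine_inverse[OF assms b] b by (simp add: mult.assoc[symmetric])
qed

lemma affine_translation_pow:
  "(1, p) [^]\<^bsub>affine_group\<^esub> (i::int) = (1, of_int i * p)"
proof -
  have nat: "(1, p) [^]\<^bsub>affine_group\<^esub> n = (1, of_nat n * p)" for n :: nat
    by (induction n) (simp_all add: algebra_simps)
  have "(1, p) [^]\<^bsub>affine_group\<^esub> (- int n) = (1, of_int (- int n) * p)" for n
    using affine.int_pow_neg_int[of "(1, p)" n] affine_inverse[of 1 "of_nat n * p" 1]
    by (simp add: nat)
  then show ?thesis by (cases i rule: int_cases2) (simp_all add: int_pow_int nat)
qed

definition translation_set :: "nat \<Rightarrow> (int fps fps \<times> int fps fps) set" where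
  "translation_set n = {(1, p) | p. vanishes n p}"

lemma subgroup_translation_set: "subgroup (translation_set n) affine_group"
proof (rule affine.subgroupI)
  have "(1, 0) \<in> translation_set n" by (simp add: translation_set_def)
  then show "translation_set n \<noteq> {}" by blast
qed (auto simp: translation_set_def affine_inverse[where b = 1] vanishes_add)

text \<open>Linear parts commute, so every commutator is a translation; its amount has order at
  least 1 because linear parts have constant term 1. Each further commutator multiplies the amount
  by some \<open>1 - a\<close>, which raises the order by at least one.\<close>

lemma lower_central_affine_group:
  "lower_central affine_group (Suc (Suc n)) \<subseteq> translation_set (Suc n)"
proof (induction n)
  case 0
  have "commutator affine_group (a, p) (b, q) \<in> translation_set 1"
    if "(a, p) \<in> carrier affine_group" "(b, q) \<in> carrier affine_group" for a p b q
  proof -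
    have "commutator affine_group (a, p) (b, q) = (1, (1 - b) * p + (a - 1) * q)"
      by (rule affine.commutator_eqI) (use that in \<open>auto simp: algebra_simps\<close>)
    moreover have "vanishes 1 ((1 - b) * p + (a - 1) * q)"
      using that vanishes_mult_left[of 1 "b - 1" "- p"] vanishes_mult_left[of 1 "a - 1" q]
      by (intro vanishes_add) (simp_all add: algebra_simps)
    ultimately show ?thesis by (simp add: translation_set_def)
  qed
  then have "{commutator affine_group g h | g h. g \<in> lower_central affine_group 1
      \<and> h \<in> carrier affine_group} \<subseteq> translation_set 1" by auto
  then have "lower_central affine_group (Suc 1) \<subseteq> translation_set 1"
    using affine.generate_subgroup_incl[OF _ subgroup_translation_set]
    by (simp only: affine.lower_central_Suc[of 1, simplified] affine.lower_central_Suc order_refl)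
  then show ?case by simp
next
  case (Suc n)
  have "commutator affine_group g h \<in> translation_set (Suc (Suc n))"
    if gh: "g \<in> lower_central affine_group (Suc (Suc n))" "h \<in> carrier affine_group" for g h
  proof -
    obtain p where g: "g = (1, p)" "vanishes (Suc n) p"
      using subsetD[OF Suc gh(1)] by (auto simp: translation_set_def)
    obtain a q where h: "h = (a, q)" by force
    have "vanishes (1 + Suc n) ((1 - a) * p)"
      using that h g vanishes_mult[of 1 "a - 1" "Suc n" "- p"] by (simp add: algebra_simps)
    then show ?thesis
      using that g h by (simp add: affine_commutator_translation translation_set_def)
  qed
  then have "{commutator affine_group g h | g h. g \<in> lower_central affine_group (Suc (Suc n))
      \<and> h \<in> carrier affine_group} \<subseteq> translation_set (Suc (Suc n))" by auto
  then show ?case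
    using affine.generate_subgroup_incl[OF _ subgroup_translation_set] affine.lower_central_Suc[of "Suc (Suc n)"]
    by (simp del: lower_central.simps)
qed

section \<open>The action of the free group\<close>

text \<open>\<open>X\<close> is the outer series variable and \<open>Y\<close> a constant series
  holding the inner one, so \<open>coeff2 f i j\<close> is the coefficient of
  \<open>X^i Y^j\<close>.\<close>

definition X :: "int fps fps" where "X = fps_X"
definition Y :: "int fps fps" where "Y = fps_const fps_X"

lemma vanishes_X: "vanishes 1 X" and vanishes_Y: "vanishes 1 Y"
  by (simp_all add: vanishes_def X_def Y_def)

lemma one_plus_fps_X_dvd_1: "(1 + fps_X :: 'a::comm_ring_1 fps) dvd 1"
proof -
  have "(1 + fps_X) * Abs_fps (\<lambda>n. (- 1) ^ n) = (1 :: 'a fps)"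
    by (rule fps_ext) (simp add: distrib_right fps_X_mult_nth power_eq_if)
  then show ?thesis by (metis dvd_triv_left)
qed

lemma fps_const_dvd_1: "a dvd 1 \<Longrightarrow> fps_const a dvd 1" for a :: "'a::comm_ring_1"
  by (metis dvd_def fps_const_1_eq_1 fps_const_mult)

lemma dvd_1_X: "1 + X dvd 1" and dvd_1_Y: "1 + Y dvd 1"
  using one_plus_fps_X_dvd_1 fps_const_dvd_1[OF one_plus_fps_X_dvd_1]
  by (simp_all add: X_def Y_def fps_const_add[symmetric] del: fps_const_add)

lemma coeff2_of_int_mult: "coeff2 (of_int k * f) i j = k * coeff2 f i j"
  by (simp add: fps_of_int[symmetric])

lemma coeff2_monomials:
  "coeff2 X 1 0 = 1"
  "coeff2 (X * X) 2 0 = 1" "coeff2 (X * X) 1 1 = 0"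
  "coeff2 (Y * X) 2 0 = 0" "coeff2 (Y * X) 1 1 = 1"
  "coeff2 (X * (X * X)) 3 0 = 1" "coeff2 (X * (X * X)) 2 1 = 0" "coeff2 (X * (X * X)) 1 2 = 0"
  "coeff2 (Y * (X * X)) 3 0 = 0" "coeff2 (Y * (X * X)) 2 1 = 1" "coeff2 (Y * (X * X)) 1 2 = 0"
  "coeff2 (Y * (Y * X)) 3 0 = 0" "coeff2 (Y * (Y * X)) 2 1 = 0" "coeff2 (Y * (Y * X)) 1 2 = 1"
  by (simp_all add: X_def Y_def fps_X_mult_nth numeral_3_eq_3 numeral_2_eq_2)

definition to_affine :: "gen2 word \<Rightarrow> int fps fps \<times> int fps fps" where
  "to_affine = free_lift affine_group (\<lambda>g. case g of Gen_x \<Rightarrow> (1 + X, 0) | Gen_y \<Rightarrow> (1 + Y, 1))"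

interpretation F2: group F2 by (rule group_free_group)

interpretation to_affine: group_hom F2 affine_group to_affine
proof unfold_locales
  have "(\<lambda>g. case g of Gen_x \<Rightarrow> (1 + X, 0) | Gen_y \<Rightarrow> (1 + Y, 1)) \<in> UNIV \<rightarrow> carrier affine_group"
    using dvd_1_X dvd_1_Y vanishes_X vanishes_Y by (auto split: gen2.split)
  then show "to_affine \<in> hom F2 affine_group"
    unfolding to_affine_def by (rule affine.free_lift_hom)
qed

abbreviation x where "x \<equiv> free_gen Gen_x"
abbreviation y where "y \<equiv> free_gen Gen_y"

lemma x_carrier [simp]: "x \<in> carrier F2" and y_carrier [simp]: "y \<in> carrier F2"
  by (simp_all add: free_gen_carrier)

lemma generate_x_y: "generate F2 {x, y} = carrier F2"
proof -
  have U: "(UNIV :: gen2 set) = {Gen_x, Gen_y}" by (auto intro: gen2.exhaust)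
  have "free_gen ` (UNIV :: gen2 set) = {x, y}" unfolding U by simp
  then show ?thesis using generate_free_gen[of "UNIV :: gen2 set"] by simp
qed

lemma to_affine_x: "to_affine x = (1 + X, 0)" and to_affine_y: "to_affine y = (1 + Y, 1)"
  using dvd_1_X dvd_1_Y vanishes_X vanishes_Y
  by (simp_all add: to_affine_def affine.free_lift_gen)

definition cxy where "cxy = commutator F2 x y"

lemma cxy_carrier [simp]: "cxy \<in> carrier F2"
  by (simp add: cxy_def)

text \<open>Every further entry contributes a factor \<open>-X\<close> or \<open>-Y\<close>; the
  signs therefore show in weight 3 and cancel in weight 4.\<close>

lemma to_affine_commutators:
  "to_affine cxy = (1, X)"
  "to_affine (commutator F2 cxy x) = (1, - (X * X))"
  "to_affine (commutator F2 cxy y) = (1, - (Y * X))"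
  "to_affine (commutator F2 (commutator F2 cxy x) x) = (1, X * (X * X))"
  "to_affine (commutator F2 (commutator F2 cxy x) y) = (1, Y * (X * X))"
  "to_affine (commutator F2 (commutator F2 cxy y) y) = (1, Y * (Y * X))"
proof -
  have mem: "(1 + X, 0) \<in> carrier affine_group" "(1 + Y, 1) \<in> carrier affine_group"
    using dvd_1_X dvd_1_Y vanishes_X vanishes_Y by simp_all
  show c: "to_affine cxy = (1, X)"
    using mem unfolding cxy_def
    by (simp add: to_affine.hom_commutator to_affine_x to_affine_y affine_commutator_linear
        del: affine_group_simps)
  show cx: "to_affine (commutator F2 cxy x) = (1, - (X * X))"
    using mem by (simp add: to_affine.hom_commutator to_affine_x c affine_commutator_translation
        del: affine_group_simps)
  show cy: "to_affine (commutator F2 cxy y) = (1, - (Y * X))"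
    using mem by (simp add: to_affine.hom_commutator to_affine_y c affine_commutator_translation
        del: affine_group_simps)
  show "to_affine (commutator F2 (commutator F2 cxy x) x) = (1, X * (X * X))"
    using mem by (simp add: to_affine.hom_commutator to_affine_x cx affine_commutator_translation
        del: affine_group_simps)
  show "to_affine (commutator F2 (commutator F2 cxy x) y) = (1, Y * (X * X))"
    using mem by (simp add: to_affine.hom_commutator to_affine_y cx affine_commutator_translation
        del: affine_group_simps)
  show "to_affine (commutator F2 (commutator F2 cxy y) y) = (1, Y * (Y * X))"
    using mem by (simp add: to_affine.hom_commutator to_affine_y cy affine_commutator_translation
        del: affine_group_simps)
qed

section \<open>Detecting lower central terms of the free group by the order of the
  translation\<close>

lemma to_affine_lower_central:
  assumes "2 \<le> n" "g \<in> lower_central F2 n"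
  obtains p where "to_affine g = (1, p)" "vanishes (n - 1) p"
proof -
  obtain m where n: "n = Suc (Suc m)" using assms(1) by (metis Suc_le_D numeral_2_eq_2 Suc_le_mono)
  have "to_affine g \<in> lower_central affine_group n"
    using to_affine.lower_central_image_subset assms by blast
  then have "to_affine g \<in> translation_set (Suc m)"
    unfolding n by (rule subsetD[OF lower_central_affine_group])
  then show ?thesis using that n by (auto simp: translation_set_def)
qed

text \<open>The converse of \<open>to_affine_lower_central\<close>, one step up. The coefficient of
  \<open>X\<close> in the translation is exactly the exponent of \<open>cxy\<close>, since the
  remaining factor contributes only order at least 2. The two criteria that follow read off
  exponents in the same way.\<close>

lemma F2_lower_central_3I:
  assumes g: "g \<in> lower_central F2 2" and v: "to_affine g = (1, p)" "vanishes 2 p"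
  shows "g \<in> lower_central F2 3"
proof -
  obtain i :: int and z where z: "z \<in> lower_central F2 3" "g = cxy [^]\<^bsub>F2\<^esub> i \<otimes>\<^bsub>F2\<^esub> z"
    using F2.lower_central_2_generators[OF x_carrier y_carrier generate_x_y g] unfolding cxy_def .
  obtain q where q: "to_affine z = (1, q)" "vanishes 2 q"
    using to_affine_lower_central[OF _ z(1)] by auto
  have zc: "z \<in> carrier F2" using z F2.lower_central_carrier by blast
  have "p = of_int i * X + q"
    using v(1) z(2) q zc
    by (simp add: to_affine.hom_int_pow to_affine_commutators affine_translation_pow)
  then have "coeff2 p 1 0 = i + coeff2 q 1 0"
    using coeff2_of_int_mult[of i X 1 0] coeff2_monomials by simp
  then have "i = 0" using v q by (simp add: vanishes_def)
  then show ?thesis using z zc by simp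
qed

lemma F2_lower_central_4I:
  assumes g: "g \<in> lower_central F2 3" and v: "to_affine g = (1, p)" "vanishes 3 p"
  shows "g \<in> lower_central F2 4"
proof -
  obtain i j :: int and z where z: "z \<in> lower_central F2 4"
    "g = commutator F2 cxy x [^]\<^bsub>F2\<^esub> i \<otimes>\<^bsub>F2\<^esub> (commutator F2 cxy y [^]\<^bsub>F2\<^esub> j \<otimes>\<^bsub>F2\<^esub> z)"
    using F2.lower_central_3_generators[OF x_carrier y_carrier generate_x_y g] unfolding cxy_def .
  obtain q where q: "to_affine z = (1, q)" "vanishes 3 q"
    using to_affine_lower_central[OF _ z(1)] by auto
  have zc: "z \<in> carrier F2" using z F2.lower_central_carrier by blast
  have p: "p = q - of_int j * (Y * X) - of_int i * (X * X)"
    using v(1) z(2) q zc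
    by (simp add: to_affine.hom_int_pow to_affine_commutators affine_translation_pow)
  have "coeff2 p 2 0 = - i + coeff2 q 2 0" "coeff2 p 1 1 = - j + coeff2 q 1 1"
    unfolding p
    by (simp_all del: One_nat_def add: coeff2_of_int_mult coeff2_monomials)
  then have "i = 0" "j = 0" using v q by (simp_all add: vanishes_def)
  then show ?thesis using z zc by simp
qed

text \<open>The three coefficients are those of the cubic monomials divisible by \<open>X\<close>,
  one for each generator of gamma_4 modulo gamma_5.\<close>

lemma F2_lower_central_5I:
  assumes g: "g \<in> lower_central F2 4" and v: "to_affine g = (1, p)"
    "coeff2 p 3 0 = 0" "coeff2 p 2 1 = 0" "coeff2 p 1 2 = 0"
  shows "g \<in> lower_central F2 5"
proof -
  obtain i j k :: int and z where z: "z \<in> lower_central F2 5"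
    "g = commutator F2 (commutator F2 cxy x) x [^]\<^bsub>F2\<^esub> i
      \<otimes>\<^bsub>F2\<^esub> (commutator F2 (commutator F2 cxy x) y [^]\<^bsub>F2\<^esub> j
      \<otimes>\<^bsub>F2\<^esub> (commutator F2 (commutator F2 cxy y) y [^]\<^bsub>F2\<^esub> k \<otimes>\<^bsub>F2\<^esub> z))"
    using F2.lower_central_4_generators[OF x_carrier y_carrier generate_x_y g] unfolding cxy_def .
  obtain q where q: "to_affine z = (1, q)" "vanishes 4 q"
    using to_affine_lower_central[OF _ z(1)] by auto
  have zc: "z \<in> carrier F2" using z F2.lower_central_carrier by blast
  have p: "p = of_int i * (X * (X * X)) + (of_int j * (Y * (X * X)) + (of_int k * (Y * (Y * X)) + q))"
    using v(1) z(2) q zc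
    by (simp add: to_affine.hom_int_pow to_affine_commutators affine_translation_pow)
  have "coeff2 p 3 0 = i + coeff2 q 3 0" "coeff2 p 2 1 = j + coeff2 q 2 1" "coeff2 p 1 2 = k + coeff2 q 1 2"
    unfolding p
    by (simp_all del: One_nat_def add: coeff2_of_int_mult coeff2_monomials)
  then have "i = 0" "j = 0" "k = 0" using v q by (simp_all add: vanishes_def)
  then show ?thesis using z zc by simp
qed

section \<open>The relator\<close>

definition relator :: "nat \<Rightarrow> gen2 word" where
  "relator r = G1_lhs r \<otimes>\<^bsub>F2\<^esub> inv\<^bsub>F2\<^esub> G1_rhs r"

definition relators :: "nat \<Rightarrow> gen2 word set" where
  "relators r = normal_closure F2 {relator r}"

lemma G1_eq: "G1 r = F2 Mod relators r"
proof -
  have "{u \<otimes>\<^bsub>F2\<^esub> inv\<^bsub>F2\<^esub> v | u v. (u, v) \<in> {(G1_lhs r, G1_rhs r)}} = {relator r}"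
    by (auto simp: relator_def)
  then show ?thesis by (simp only: G1_def presented_group_def relators_def)
qed

text \<open>Both sides of the defining relation are conjugates of \<open>x\<close>, so it says that \<open>x\<close> commutes with
  \<open>y x\<^sup>r y\<^sup>-\<^sup>2 x\<^sup>r y\<close>.\<close>

lemma relator_eq:
  fixes r :: nat
  defines "k \<equiv> y \<otimes>\<^bsub>F2\<^esub> x [^]\<^bsub>F2\<^esub> r"
    and "w \<equiv> y \<otimes>\<^bsub>F2\<^esub> x [^]\<^bsub>F2\<^esub> r \<otimes>\<^bsub>F2\<^esub> inv\<^bsub>F2\<^esub> y \<otimes>\<^bsub>F2\<^esub> inv\<^bsub>F2\<^esub> y \<otimes>\<^bsub>F2\<^esub> x [^]\<^bsub>F2\<^esub> r \<otimes>\<^bsub>F2\<^esub> y"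
  shows "relator r = inv\<^bsub>F2\<^esub> k \<otimes>\<^bsub>F2\<^esub> commutator F2 x w \<otimes>\<^bsub>F2\<^esub> k"
proof -
  have y2: "y [^]\<^bsub>F2\<^esub> (2::int) = y \<otimes>\<^bsub>F2\<^esub> y"
    using F2.int_pow_mult[of y 1 1] by (simp add: F2.int_pow_1)
  have y2n: "y [^]\<^bsub>F2\<^esub> (- 2::int) = inv\<^bsub>F2\<^esub> (y \<otimes>\<^bsub>F2\<^esub> y)"
    using F2.int_pow_neg[of y 2] y2 by simp
  have xr: "x [^]\<^bsub>F2\<^esub> int r = x [^]\<^bsub>F2\<^esub> r" "x [^]\<^bsub>F2\<^esub> (- int r) = inv\<^bsub>F2\<^esub> (x [^]\<^bsub>F2\<^esub> r)"
    by (simp_all add: int_pow_int F2.int_pow_neg)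
  show ?thesis
    unfolding relator_def G1_lhs_def G1_rhs_def Let_def y2 y2n xr k_def w_def
    by (simp add: F2.word_simps)
qed

lemma relator_carrier [simp]: "relator r \<in> carrier F2"
  by (simp add: relator_eq)

lemma one_plus_X_power: "\<exists>s. (1 + X) ^ r = 1 + of_nat r * X + X * X * s"
proof (induction r)
  case 0
  show ?case by (intro exI[of _ 0]) simp
next
  case (Suc r)
  then obtain s where "(1 + X) ^ r = 1 + of_nat r * X + X * X * s" by blast
  \<comment> \<open>The witness collects the terms of degree at least 2 in
    \<open>(1 + X) * (1 + r X + X^2 s)\<close>.\<close>
  then show ?case by (intro exI[of _ "of_nat r + s + X * s"]) (simp add: algebra_simps)
qed

lemma to_affine_conj_translation:
  assumes g: "g \<in> carrier F2" and h: "h \<in> carrier F2" "to_affine h = (1, p)"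
  obtains a where "vanishes 1 (a - 1)"
    "to_affine (g \<otimes>\<^bsub>F2\<^esub> h \<otimes>\<^bsub>F2\<^esub> inv\<^bsub>F2\<^esub> g) = (1, a * p)"
proof -
  obtain a q where aq: "to_affine g = (a, q)" by force
  then have mem: "(a, q) \<in> carrier affine_group" using to_affine.hom_closed[OF g] by simp
  show ?thesis
    using that[of a] mem g h by (simp add: aq affine_conj_translation[OF mem] del: affine_group_simps(2))
qed

text \<open>The word \<open>w\<close> has translation part \<open>V * (a - 1) * (a - 1 - Y)\<close>,
  commutation with \<open>x\<close> multiplies this by \<open>X\<close>, and conjugation by a factor
  \<open>b\<close> of constant term 1. As \<open>a - 1\<close> begins with \<open>r X\<close> and
  \<open>V\<close> with 1, the leading form is the product of \<open>X\<close>, \<open>r X\<close>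
  and \<open>r X - Y\<close>.\<close>

lemma to_affine_relator:
  obtains p where "to_affine (relator r) = (1, p)"
    "vanishes 4 (p - (of_int (int r * int r) * (X * (X * X)) - of_int (int r) * (Y * (X * X))))"
proof -
  define a where "a = (1 + X) ^ r"
  define k where "k = y \<otimes>\<^bsub>F2\<^esub> x [^]\<^bsub>F2\<^esub> r"
  define w where "w = y \<otimes>\<^bsub>F2\<^esub> x [^]\<^bsub>F2\<^esub> r \<otimes>\<^bsub>F2\<^esub> inv\<^bsub>F2\<^esub> y \<otimes>\<^bsub>F2\<^esub> inv\<^bsub>F2\<^esub> y \<otimes>\<^bsub>F2\<^esub> x [^]\<^bsub>F2\<^esub> r \<otimes>\<^bsub>F2\<^esub> y"
  have kw: "k \<in> carrier F2" "w \<in> carrier F2" by (simp_all add: k_def w_def)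
  obtain V where V: "(1 + Y) * V = 1" using dvd_1_Y by (metis dvd_def)
  have mem: "(1 + X, 0) \<in> carrier affine_group" "(1 + Y, 1) \<in> carrier affine_group"
    using dvd_1_X dvd_1_Y vanishes_X vanishes_Y by simp_all
  have V1: "vanishes 1 (V - 1)" using vanishes_inverse[OF _ V] vanishes_Y by simp
  have pow: "(1 + X, 0) [^]\<^bsub>affine_group\<^esub> n = ((1 + X) ^ n, 0)" for n :: nat
    by (induction n) (simp_all add: mult.commute)
  have "to_affine (x [^]\<^bsub>F2\<^esub> r) = (a, 0)"
    using to_affine.hom_nat_pow[OF x_carrier, of r] by (simp add: to_affine_x pow a_def)
  moreover have "to_affine (inv\<^bsub>F2\<^esub> y) = (V, - V)"
    using affine_inverse[OF mem(2) V] to_affine.hom_inv[OF y_carrier] by (simp add: to_affine_y)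
  ultimately have tw: "to_affine w = ((1 + Y) * a * V * V * a * (1 + Y),
      1 + (1 + Y) * a * (- V) + (1 + Y) * a * V * (- V) + (1 + Y) * a * V * V * a)"
    by (simp add: w_def to_affine_y algebra_simps)
  define t where "t = V * ((a - 1) * (a - 1 - Y))"
  \<comment> \<open>The summand \<open>1 - (1 + Y) * V\<close> is zero; it turns the substitution of
    1 for \<open>(1 + Y) * V\<close> into a plain ring identity.\<close>
  have "1 + (1 + Y) * a * (- V) + (1 + Y) * a * V * (- V) + (1 + Y) * a * V * V * a
      = (1 + Y) * V * (1 - a - a * V + a * a * V) + (1 - (1 + Y) * V)"
    by (simp add: algebra_simps)
  also have "\<dots> = (1 + Y) * V - a * ((1 + Y) * V) - a * V + a * a * V"
    using V by (simp add: algebra_simps)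
  also have "\<dots> = t" by (simp add: t_def algebra_simps)
  finally have "to_affine w = ((1 + Y) * a * V * V * a * (1 + Y), t)" using tw by simp
  then have "to_affine (commutator F2 x w) = (1, X * t)"
    using affine_commutator_linear[OF mem(1)] to_affine.hom_closed[OF kw(2)] kw
    by (simp add: to_affine.hom_commutator to_affine_x del: affine_group_simps)
  then obtain b where b: "vanishes 1 (b - 1)" "to_affine (inv\<^bsub>F2\<^esub> k \<otimes>\<^bsub>F2\<^esub> commutator F2 x w
      \<otimes>\<^bsub>F2\<^esub> inv\<^bsub>F2\<^esub> (inv\<^bsub>F2\<^esub> k)) = (1, b * (X * t))"
    using to_affine_conj_translation[of "inv\<^bsub>F2\<^esub> k" "commutator F2 x w"] kw by auto
  then have rel: "to_affine (relator r) = (1, b * (X * t))"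
    using kw by (simp add: relator_eq k_def w_def)
  obtain s where s: "a = 1 + of_nat r * X + X * X * s"
    using one_plus_X_power[of r] by (auto simp: a_def)
  define f where "f = of_nat r * X + X * X * s"
  have XX: "vanishes 2 (X * X * s)"
    using vanishes_mult[OF vanishes_mult[OF vanishes_X vanishes_X], of 0 s]
    by (simp add: numeral_2_eq_2)
  have f1: "vanishes 1 f"
    unfolding f_def by (intro vanishes_add vanishes_mult_left vanishes_X vanishes_mono[OF XX]) simp
  have M: "vanishes 3 (X * (f * (f - Y)))"
    using vanishes_mult[OF vanishes_X vanishes_mult[OF f1 vanishes_diff[OF f1 vanishes_Y]]]
    by (simp add: numeral_3_eq_3)
  let ?M0 = "of_int (int r * int r) * (X * (X * X)) - of_int (int r) * (Y * (X * X))"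
  \<comment> \<open>The error of replacing \<open>f\<close> by its linear term \<open>r X\<close>,
    one factor at a time: the two summands come from the first and from the second factor of
    \<open>f * (f - Y)\<close>.\<close>
  have "vanishes 4 (X * (X * X * s * (f - Y)) + X * (of_nat r * X * (X * X * s)))"
  proof (intro vanishes_add)
    show "vanishes 4 (X * (X * X * s * (f - Y)))"
      using vanishes_mult[OF vanishes_X vanishes_mult[OF XX vanishes_diff[OF f1 vanishes_Y]]] by simp
    show "vanishes 4 (X * (of_nat r * X * (X * X * s)))"
      using vanishes_mult[OF vanishes_X vanishes_mult[OF vanishes_mult_left[OF vanishes_X] XX]]
      by (simp add: eval_nat_numeral)
  qed
  also have "X * (X * X * s * (f - Y)) + X * (of_nat r * X * (X * X * s)) = X * (f * (f - Y)) - ?M0"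
    by (simp add: f_def algebra_simps)
  finally have M0: "vanishes 4 (X * (f * (f - Y)) - ?M0)" .
  \<comment> \<open>The unit \<open>b * V\<close> has constant term 1 and multiplies a series of
    order at least 3, so it affects only terms of order at least 4.\<close>
  have "vanishes 4 ((b * V - 1) * (X * (f * (f - Y))) + (X * (f * (f - Y)) - ?M0))"
    using vanishes_mult[OF vanishes_mult_minus_one[OF b(1) V1] M] M0 by (intro vanishes_add) simp_all
  also have "(b * V - 1) * (X * (f * (f - Y))) + (X * (f * (f - Y)) - ?M0) = b * (X * t) - ?M0"
    by (simp add: t_def s f_def algebra_simps)
  finally show ?thesis using that rel by blast
qed

text \<open>No commutator expansion is needed: as a conjugate of a commutator the relator lies in
  gamma_2, and since its translation has order at least 3 the detection criteria lift it to gamma_3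
  and then to gamma_4.\<close>

lemma relator_lower_central: "relator r \<in> lower_central F2 4"
proof -
  obtain p where p: "to_affine (relator r) = (1, p)"
    "vanishes 4 (p - (of_int (int r * int r) * (X * (X * X)) - of_int (int r) * (Y * (X * X))))"
    by (rule to_affine_relator)
  have "vanishes 3 (X * (X * X))" "vanishes 3 (Y * (X * X))"
    using vanishes_mult[OF vanishes_X vanishes_mult[OF vanishes_X vanishes_X]]
      vanishes_mult[OF vanishes_Y vanishes_mult[OF vanishes_X vanishes_X]]
    by (simp_all add: numeral_3_eq_3)
  then have "vanishes 3 (of_int (int r * int r) * (X * (X * X)) - of_int (int r) * (Y * (X * X)))"
    by (simp only: vanishes_diff vanishes_mult_left)
  from vanishes_add[OF vanishes_mono[OF p(2), of 3] this] have v: "vanishes 3 p" by simp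
  let ?w = "y \<otimes>\<^bsub>F2\<^esub> x [^]\<^bsub>F2\<^esub> r \<otimes>\<^bsub>F2\<^esub> inv\<^bsub>F2\<^esub> y \<otimes>\<^bsub>F2\<^esub> inv\<^bsub>F2\<^esub> y \<otimes>\<^bsub>F2\<^esub> x [^]\<^bsub>F2\<^esub> r \<otimes>\<^bsub>F2\<^esub> y"
  have "commutator F2 x ?w \<in> lower_central F2 2"
    using F2.commutator_lower_central[of 1 x ?w] by (simp add: numeral_2_eq_2)
  from F2.normal_conj_mem[OF F2.lower_central_normal this, of "inv\<^bsub>F2\<^esub> (y \<otimes>\<^bsub>F2\<^esub> x [^]\<^bsub>F2\<^esub> r)"]
  have "relator r \<in> lower_central F2 2" by (simp add: relator_eq)
  then have "relator r \<in> lower_central F2 3"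
    using p(1) vanishes_mono[OF v, of 2] by (intro F2_lower_central_3I) simp_all
  then show ?thesis using p v by (intro F2_lower_central_4I)
qed

section \<open>The one-relator quotient\<close>

lemma (in group) restrict_group_hom:
  assumes "group_hom G H h" "subgroup A G" "subgroup B H" "h ` A \<subseteq> B"
  shows "group_hom (G\<lparr>carrier := A\<rparr>) (H\<lparr>carrier := B\<rparr>) h"
proof -
  interpret h: group_hom G H h by fact
  have "h (a \<otimes> b) = h a \<otimes>\<^bsub>H\<^esub> h b" if "a \<in> A" "b \<in> A" for a b
    using that subgroup.mem_carrier[OF assms(2)] by simp
  then have "h \<in> hom (G\<lparr>carrier := A\<rparr>) (H\<lparr>carrier := B\<rparr>)"
    using assms(4) by (auto simp: hom_def)
  then show ?thesis
    using assms(2,3) by (simp add: group_hom_def group_hom_axioms_def subgroup_imp_group h.H.subgroup_imp_group)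
qed

context normal
begin

lemma coset_mem_image_iff:
  assumes g: "g \<in> carrier G" and A: "A \<subseteq> carrier G"
  shows "H #> g \<in> (#>) H ` A \<longleftrightarrow> (\<exists>a\<in>A. g \<otimes> inv a \<in> H)"
proof -
  have "H #> g = H #> a \<longleftrightarrow> g \<otimes> inv a \<in> H" if "a \<in> A" for a
  proof
    have a: "a \<in> carrier G" using that A by blast
    assume "H #> g = H #> a"
    then have "g \<in> H #> a" using rcos_self[OF g subgroup_axioms] by simp
    then obtain n where "n \<in> H" "g = n \<otimes> a" by (auto simp: r_coset_def)
    then show "g \<otimes> inv a \<in> H" using a by (simp add: m_assoc)
  next
    have a: "a \<in> carrier G" using that A by blast
    assume "g \<otimes> inv a \<in> H"
    then have "(g \<otimes> inv a) \<otimes> a \<in> H #> a" by (auto simp: r_coset_def)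
    then have "g \<in> H #> a" using a g by (simp add: m_assoc)
    then show "H #> g = H #> a" using repr_independence a subgroup_axioms by simp
  qed
  then show ?thesis by (auto simp: image_iff)
qed

lemma coset_eq_iff_mem: "g \<in> carrier G \<Longrightarrow> H #> g = H \<longleftrightarrow> g \<in> H"
  using coset_join1[OF _ _ subgroup_axioms] coset_join2[OF _ subgroup_axioms] by blast

end

lemma F2_relators_normal: "relators r \<lhd> F2"
  unfolding relators_def by (rule F2.normal_closure_normal) simp

lemma relators_lower_central: "relators r \<subseteq> lower_central F2 4"
  unfolding relators_def normal_closure_def
proof (rule F2.generate_subgroup_incl[OF _ F2.lower_central_subgroup])
  show "{g \<otimes>\<^bsub>F2\<^esub> s \<otimes>\<^bsub>F2\<^esub> inv\<^bsub>F2\<^esub> g | g s. g \<in> carrier F2 \<and> s \<in> {relator r}} \<subseteq> lower_central F2 4"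
    using F2.normal_conj_mem[OF F2.lower_central_normal relator_lower_central] by blast
qed

lemma G1_hom: "group_hom F2 (G1 r) ((#>\<^bsub>F2\<^esub>) (relators r))"
  unfolding G1_eq by (rule normal.quotient_group_hom[OF F2_relators_normal])

lemma group_G1: "group (G1 r)"
  using G1_hom group_hom.axioms(2) by blast

lemma G1_lower_central: "lower_central (G1 r) n = (#>\<^bsub>F2\<^esub>) (relators r) ` lower_central F2 n"
proof -
  interpret group_hom F2 "G1 r" "(#>\<^bsub>F2\<^esub>) (relators r)" by (rule G1_hom)
  show ?thesis by (rule lower_central_image[symmetric]) (simp add: G1_eq carrier_FactGroup)
qed

lemma G1_coset_lower_central_iff:
  assumes "g \<in> carrier F2"
  shows "relators r #>\<^bsub>F2\<^esub> g \<in> lower_central (G1 r) n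
    \<longleftrightarrow> (\<exists>z\<in>lower_central F2 n. g \<otimes>\<^bsub>F2\<^esub> inv\<^bsub>F2\<^esub> z \<in> relators r)"
  unfolding G1_lower_central using F2.lower_central_carrier
  by (intro normal.coset_mem_image_iff[OF F2_relators_normal assms]) blast

text \<open>The preimage of the \<open>n\<close>-th term of the quotient is gamma_n R, and this is
  gamma_n because R lies in gamma_4 and hence in gamma_n.\<close>

lemma G1_coset_lower_central_le_4_iff:
  assumes g: "g \<in> carrier F2" and n: "n \<le> 4"
  shows "relators r #>\<^bsub>F2\<^esub> g \<in> lower_central (G1 r) n \<longleftrightarrow> g \<in> lower_central F2 n"
proof
  interpret n: subgroup "lower_central F2 n" F2 by (rule F2.lower_central_subgroup)
  assume "relators r #>\<^bsub>F2\<^esub> g \<in> lower_central (G1 r) n"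
  then obtain z where z: "z \<in> lower_central F2 n" "g \<otimes>\<^bsub>F2\<^esub> inv\<^bsub>F2\<^esub> z \<in> relators r"
    using G1_coset_lower_central_iff[OF g] by blast
  then have "g \<otimes>\<^bsub>F2\<^esub> inv\<^bsub>F2\<^esub> z \<in> lower_central F2 n"
    using relators_lower_central F2.lower_central_antimono[OF n] by blast
  then have "(g \<otimes>\<^bsub>F2\<^esub> inv\<^bsub>F2\<^esub> z) \<otimes>\<^bsub>F2\<^esub> z \<in> lower_central F2 n"
    using z by blast
  then show "g \<in> lower_central F2 n" using g z by (simp add: F2.m_assoc)
qed (simp add: G1_lower_central)

section \<open>The leading form as a homomorphism on gamma_4\<close>

definition target :: "nat \<Rightarrow> (int \<times> int \<times> int) monoid" where
  "target r = integer_group \<times>\<times> integer_group \<times>\<times> integer_mod_group r"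

text \<open>The leading form of the relator has coefficients \<open>(r\<^sup>2, -r, 0)\<close>; these linear forms have
  its integer multiples as their common kernel.\<close>

definition leading :: "nat \<Rightarrow> gen2 word \<Rightarrow> int \<times> int \<times> int" where
  "leading r g = (let p = snd (to_affine g) in
     (coeff2 p 3 0 + int r * coeff2 p 2 1, coeff2 p 1 2, coeff2 p 2 1 mod int r))"

lemma group_target: "group (target r)"
  by (simp add: target_def DirProd_group)

text \<open>Elements of gamma_4 act by translations, whose composition adds the amounts; this is why
  the map is considered on gamma_4 and not on the whole group.\<close>

lemma leading_hom:
  assumes "r > 0"
  shows "group_hom (F2\<lparr>carrier := lower_central F2 4\<rparr>) (target r) (leading r)"
proof -
  have "leading r (g \<otimes>\<^bsub>F2\<^esub> h) = leading r g \<otimes>\<^bsub>target r\<^esub> leading r h"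
    if gh: "g \<in> lower_central F2 4" "h \<in> lower_central F2 4" for g h
  proof -
    obtain p where "to_affine g = (1, p)" using to_affine_lower_central[OF _ gh(1)] by auto
    moreover obtain q where "to_affine h = (1, q)"
      using to_affine_lower_central[OF _ gh(2)] by auto
    moreover have "g \<in> carrier F2" "h \<in> carrier F2" using gh F2.lower_central_carrier by blast+
    ultimately show ?thesis
      by (simp add: leading_def target_def Let_def mod_simps algebra_simps)
  qed
  moreover have "leading r g \<in> carrier (target r)" for g
    using assms by (simp add: leading_def target_def Let_def carrier_integer_mod_group)
  ultimately have "leading r \<in> hom (F2\<lparr>carrier := lower_central F2 4\<rparr>) (target r)"
    by (auto simp: hom_def)
  then show ?thesis
    using F2.subgroup_imp_group[OF F2.lower_central_subgroup] group_target
    by (simp add: group_hom_def group_hom_axioms_def)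
qed

lemma leading_surj:
  assumes r: "r > 0"
  shows "leading r ` lower_central F2 4 = carrier (target r)"
proof
  interpret L: group_hom "F2\<lparr>carrier := lower_central F2 4\<rparr>" "target r" "leading r"
    by (rule leading_hom[OF r])
  show "leading r ` lower_central F2 4 \<subseteq> carrier (target r)"
    using L.hom_closed by auto
  show "carrier (target r) \<subseteq> leading r ` lower_central F2 4"
  proof
    fix t assume "t \<in> carrier (target r)"
    then obtain a b c where t: "t = (a, b, c)" "0 \<le> c" "c < int r"
      using r by (auto simp: target_def carrier_integer_mod_group)
    let ?cx = "commutator F2 cxy x" and ?cy = "commutator F2 cxy y"
    \<comment> \<open>The first exponent is corrected by \<open>r * c\<close> because the first
      linear form adds \<open>r\<close> times the coefficient of \<open>Y * (X * X)\<close>, which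
      is \<open>c\<close> here. The bounds on \<open>c\<close> make it its own residue.\<close>
    let ?g = "commutator F2 ?cx x [^]\<^bsub>F2\<^esub> (a - int r * c) \<otimes>\<^bsub>F2\<^esub>
      (commutator F2 ?cx y [^]\<^bsub>F2\<^esub> c \<otimes>\<^bsub>F2\<^esub> commutator F2 ?cy y [^]\<^bsub>F2\<^esub> b)"
    have c2: "cxy \<in> lower_central F2 2"
      using F2.commutator_lower_central[of 1 x y] by (simp add: cxy_def numeral_2_eq_2)
    have c3: "?cx \<in> lower_central F2 3" "?cy \<in> lower_central F2 3"
      using F2.commutator_lower_central[of 2 cxy] c2 by simp_all
    have "commutator F2 ?cx x \<in> lower_central F2 4" "commutator F2 ?cx y \<in> lower_central F2 4"
      "commutator F2 ?cy y \<in> lower_central F2 4"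
      using F2.commutator_lower_central[of 3] c3 by simp_all
    then have g: "?g \<in> lower_central F2 4"
      using F2.lower_central_subgroup
      by (intro subgroup.m_closed[OF F2.lower_central_subgroup]
        F2.subgroup_int_pow_closed[OF F2.lower_central_subgroup])
    have "snd (to_affine ?g) = of_int (a - int r * c) * (X * (X * X))
        + (of_int c * (Y * (X * X)) + of_int b * (Y * (Y * X)))"
      by (simp add: to_affine.hom_int_pow to_affine_commutators affine_translation_pow)
    then have "leading r ?g = t"
      using t unfolding leading_def Let_def
      by (simp del: One_nat_def of_int_diff add: coeff2_of_int_mult coeff2_monomials)
    then show "t \<in> leading r ` lower_central F2 4" using g by blast
  qed
qed

text \<open>The translation of the relator has order at least 3 and conjugation multiplies it by a
  series with constant term 1, so the terms of degree 3 are the same for all conjugates.\<close>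

lemma coeff2_conj_relator:
  assumes g: "g \<in> carrier F2"
    and p: "to_affine (g \<otimes>\<^bsub>F2\<^esub> relator r \<otimes>\<^bsub>F2\<^esub> inv\<^bsub>F2\<^esub> g) = (1, p)"
  shows "coeff2 p 3 0 = int r * int r" "coeff2 p 2 1 = - int r" "coeff2 p 1 2 = 0"
proof -
  obtain q where q: "to_affine (relator r) = (1, q)"
    "vanishes 4 (q - (of_int (int r * int r) * (X * (X * X)) - of_int (int r) * (Y * (X * X))))"
    (is "vanishes 4 (q - ?M)")
    by (rule to_affine_relator)
  obtain q' where "to_affine (relator r) = (1, q')" "vanishes 3 q'"
    using to_affine_lower_central[OF _ relator_lower_central] by auto
  then have q3: "vanishes 3 q" using q by simp
  obtain a where a: "vanishes 1 (a - 1)" "p = a * q"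
    using to_affine_conj_translation[OF g relator_carrier q(1)] p by auto
  have "vanishes 4 ((a - 1) * q + (q - ?M))"
    using vanishes_mult[OF a(1) q3] q(2) by (intro vanishes_add) simp_all
  also have "(a - 1) * q + (q - ?M) = p - ?M" using a by (simp add: algebra_simps)
  finally have "coeff2 p i j = coeff2 ?M i j" if "i + j < 4" for i j
    using that by (simp add: vanishes_def)
  then show "coeff2 p 3 0 = int r * int r" "coeff2 p 2 1 = - int r" "coeff2 p 1 2 = 0"
    by (simp_all del: One_nat_def of_int_mult add: coeff2_of_int_mult coeff2_monomials)
qed

text \<open>On the coefficients \<open>(r * r, -r, 0)\<close> of any conjugate the forms give
  \<open>r * r - r * r\<close>, 0 and \<open>-r mod r\<close>. The kernel is a subgroup of the free
  group, so this extends to the whole normal closure.\<close>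

lemma leading_relators:
  assumes r: "r > 0" and g: "g \<in> relators r"
  shows "leading r g = \<one>\<^bsub>target r\<^esub>"
proof -
  interpret L: group_hom "F2\<lparr>carrier := lower_central F2 4\<rparr>" "target r" "leading r"
    by (rule leading_hom[OF r])
  let ?K = "kernel (F2\<lparr>carrier := lower_central F2 4\<rparr>) (target r) (leading r)"
  have K: "subgroup ?K F2"
    using F2.incl_subgroup[OF F2.lower_central_subgroup L.subgroup_kernel] .
  have "relators r \<subseteq> ?K"
    unfolding relators_def normal_closure_def
  proof (rule F2.generate_subgroup_incl[OF _ K], safe)
    fix g assume g: "g \<in> carrier F2"
    let ?h = "g \<otimes>\<^bsub>F2\<^esub> relator r \<otimes>\<^bsub>F2\<^esub> inv\<^bsub>F2\<^esub> g"
    have h: "?h \<in> lower_central F2 4"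
      using F2.normal_conj_mem[OF F2.lower_central_normal relator_lower_central g] .
    obtain p where "to_affine ?h = (1, p)"
      using to_affine_lower_central[OF _ h] by auto
    then have "leading r ?h = \<one>\<^bsub>target r\<^esub>"
      using coeff2_conj_relator[OF g] by (simp add: leading_def target_def Let_def)
    then show "?h \<in> ?K" using h by (simp add: kernel_def)
  qed
  then show ?thesis using g by (auto simp: kernel_def)
qed

lemma leading_lower_central_5:
  assumes "z \<in> lower_central F2 5"
  shows "leading r z = \<one>\<^bsub>target r\<^esub>"
proof -
  obtain p where "to_affine z = (1, p)" "vanishes 4 p"
    using to_affine_lower_central[OF _ assms] by auto
  then show ?thesis by (simp add: leading_def target_def Let_def vanishes_def)
qed

text \<open>The right side says that \<open>g\<close> lies in gamma_5 R, so the kernel of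
  \<open>leading r\<close> on gamma_4 is precisely what dies in the last quotient of the
  theorem.\<close>

lemma leading_eq_one_iff:
  assumes r: "r > 0" and g: "g \<in> lower_central F2 4"
  shows "leading r g = \<one>\<^bsub>target r\<^esub> \<longleftrightarrow> relators r #>\<^bsub>F2\<^esub> g \<in> lower_central (G1 r) 5"
proof -
  interpret L: group_hom "F2\<lparr>carrier := lower_central F2 4\<rparr>" "target r" "leading r"
    by (rule leading_hom[OF r])
  interpret N: normal "relators r" F2 by (rule F2_relators_normal)
  interpret G4: subgroup "lower_central F2 4" F2 by (rule F2.lower_central_subgroup)
  have gc: "g \<in> carrier F2" using g by simp
  show ?thesis
  proof
    assume 1: "leading r g = \<one>\<^bsub>target r\<^esub>"
    obtain p where p: "to_affine g = (1, p)" using to_affine_lower_central[OF _ g] by auto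
    obtain q where q: "to_affine (relator r) = (1, q)"
      using to_affine_lower_central[OF _ relator_lower_central] by auto
    have qc: "coeff2 q 3 0 = int r * int r" "coeff2 q 2 1 = - int r" "coeff2 q 1 2 = 0"
      using coeff2_conj_relator[of "\<one>\<^bsub>F2\<^esub>" r q] q by simp_all
    have pc: "coeff2 p 3 0 + int r * coeff2 p 2 1 = 0" "coeff2 p 1 2 = 0" "int r dvd coeff2 p 2 1"
      using 1 p by (simp_all add: leading_def target_def Let_def dvd_eq_mod_eq_0)
    \<comment> \<open>The leading coefficients of \<open>g\<close> are now
      \<open>(-r * r * m, r * m, 0)\<close>, which is \<open>-m\<close> times those of the relator.
      Multiplying \<open>g\<close> by the \<open>m\<close>-th power of the relator cancels
      them.\<close>
    then obtain m where m: "coeff2 p 2 1 = int r * m" by (auto simp: dvd_def)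
    let ?n = "relator r [^]\<^bsub>F2\<^esub> m" and ?z = "g \<otimes>\<^bsub>F2\<^esub> relator r [^]\<^bsub>F2\<^esub> m"
    have "relator r \<in> relators r"
      unfolding relators_def normal_closure_def
      by (rule generate.incl) (auto intro!: exI[of _ "\<one>\<^bsub>F2\<^esub>"])
    then have n: "?n \<in> relators r" by (rule F2.subgroup_int_pow_closed[OF N.subgroup_axioms])
    then have z4: "?z \<in> lower_central F2 4" using g relators_lower_central by blast
    have "to_affine ?z = (1, p + of_int m * q)"
      using p q gc by (simp add: to_affine.hom_int_pow affine_translation_pow add.commute)
    then have z: "?z \<in> lower_central F2 5"
    proof (rule F2_lower_central_5I[OF z4])
      show "coeff2 (p + of_int m * q) 3 0 = 0"
        using pc(1) unfolding m by (simp add: coeff2_of_int_mult qc algebra_simps)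
      show "coeff2 (p + of_int m * q) 2 1 = 0"
        by (simp add: coeff2_of_int_mult qc m algebra_simps del: One_nat_def)
      show "coeff2 (p + of_int m * q) 1 2 = 0"
        by (simp add: coeff2_of_int_mult qc pc del: One_nat_def)
    qed
    have "g \<otimes>\<^bsub>F2\<^esub> inv\<^bsub>F2\<^esub> ?z = g \<otimes>\<^bsub>F2\<^esub> inv\<^bsub>F2\<^esub> ?n \<otimes>\<^bsub>F2\<^esub> inv\<^bsub>F2\<^esub> g"
      using gc by (simp add: F2.word_simps)
    also have "\<dots> \<in> relators r" using n gc by (intro F2.normal_conj_mem[OF F2_relators_normal]) auto
    finally show "relators r #>\<^bsub>F2\<^esub> g \<in> lower_central (G1 r) 5"
      using z G1_coset_lower_central_iff[OF gc] by blast
  next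
    assume "relators r #>\<^bsub>F2\<^esub> g \<in> lower_central (G1 r) 5"
    then obtain z where z: "z \<in> lower_central F2 5" "g \<otimes>\<^bsub>F2\<^esub> inv\<^bsub>F2\<^esub> z \<in> relators r"
      using G1_coset_lower_central_iff[OF gc] by blast
    have z4: "z \<in> lower_central F2 4" using z F2.lower_central_antimono[of 4 5] by auto
    have n4: "g \<otimes>\<^bsub>F2\<^esub> inv\<^bsub>F2\<^esub> z \<in> lower_central F2 4" using z relators_lower_central by blast
    have "leading r g = leading r ((g \<otimes>\<^bsub>F2\<^esub> inv\<^bsub>F2\<^esub> z) \<otimes>\<^bsub>F2\<^esub> z)"
      using gc z4 by (simp add: F2.m_assoc)
    also have "\<dots> = leading r (g \<otimes>\<^bsub>F2\<^esub> inv\<^bsub>F2\<^esub> z) \<otimes>\<^bsub>target r\<^esub> leading r z"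
      using L.hom_mult[of "g \<otimes>\<^bsub>F2\<^esub> inv\<^bsub>F2\<^esub> z" z] z4 n4 by simp
    also have "\<dots> = \<one>\<^bsub>target r\<^esub>"
      using leading_relators[OF r z(2)] leading_lower_central_5[OF z(1)] by simp
    finally show "leading r g = \<one>\<^bsub>target r\<^esub>" .
  qed
qed

section \<open>The two quotients and the strict descent of the series\<close>

lemma G1_lower_central_4_quotient_iso: "G1 r Mod lower_central (G1 r) 4 \<cong> F2 Mod lower_central F2 4"
proof -
  interpret G: group "G1 r" by (rule group_G1)
  let ?L = "lower_central (G1 r) 4" and ?\<pi> = "(#>\<^bsub>F2\<^esub>) (relators r)"
  interpret L: normal ?L "G1 r" by (rule G.lower_central_normal)
  interpret p: group_hom F2 "G1 r" ?\<pi> by (rule G1_hom)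
  interpret q: group_hom "G1 r" "G1 r Mod ?L" "(#>\<^bsub>G1 r\<^esub>) ?L" by (rule L.quotient_group_hom)
  \<comment> \<open>The first isomorphism theorem is applied to the composite of both projections;
    its kernel is the preimage of gamma_4 of the quotient, which is gamma_4 of the free
    group.\<close>
  let ?h = "\<lambda>g. ?L #>\<^bsub>G1 r\<^esub> ?\<pi> g"
  interpret h: group_hom F2 "G1 r Mod ?L" ?h
    using hom_compose[OF p.homh q.homh]
    by (intro group_hom.intro group_hom_axioms.intro) (simp_all add: comp_def)
  have "?h g = \<one>\<^bsub>G1 r Mod ?L\<^esub> \<longleftrightarrow> ?\<pi> g \<in> ?L" if "g \<in> carrier F2" for g
    using L.coset_eq_iff_mem[OF p.hom_closed[OF that]] by simp
  then have "kernel F2 (G1 r Mod ?L) ?h = {g \<in> carrier F2. ?\<pi> g \<in> ?L}"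
    unfolding kernel_def by (intro Collect_cong conj_cong refl)
  also have "\<dots> = lower_central F2 4"
    using G1_coset_lower_central_le_4_iff F2.lower_central_carrier by auto
  finally have ker: "kernel F2 (G1 r Mod ?L) ?h = lower_central F2 4" .
  have car: "carrier (G1 r) = ?\<pi> ` carrier F2" by (simp only: G1_eq carrier_FactGroup)
  have "?h ` carrier F2 = (#>\<^bsub>G1 r\<^esub>) ?L ` ?\<pi> ` carrier F2"
    by (rule image_image[symmetric])
  also have "\<dots> = carrier (G1 r Mod ?L)" unfolding car[symmetric] by (rule carrier_FactGroup[symmetric])
  finally have "?h ` carrier F2 = carrier (G1 r Mod ?L)" .
  then have "F2 Mod lower_central F2 4 \<cong> G1 r Mod ?L"
    using h.FactGroup_iso ker by simp
  then show ?thesis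
    by (rule group.iso_sym[OF normal.factorgroup_is_group[OF F2.lower_central_normal]])
qed

text \<open>Two surjections leave gamma_4 of the free group, one onto the quotient in question and
  one, \<open>leading r\<close>, onto the target. By \<open>leading_eq_one_iff\<close> their kernels
  agree, so their images are isomorphic.\<close>

lemma G1_lower_central_5_quotient_iso:
  assumes r: "r > 0"
  shows "(G1 r)\<lparr>carrier := lower_central (G1 r) 4\<rparr> Mod lower_central (G1 r) 5 \<cong> target r"
proof -
  interpret G: group "G1 r" by (rule group_G1)
  let ?F4 = "F2\<lparr>carrier := lower_central F2 4\<rparr>"
  let ?G4 = "(G1 r)\<lparr>carrier := lower_central (G1 r) 4\<rparr>"
  let ?L = "lower_central (G1 r) 5" and ?\<pi> = "(#>\<^bsub>F2\<^esub>) (relators r)"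
  have "?L \<lhd> ?G4"
    using G.lower_central_antimono[of 4 5]
    by (intro G.normal_restrict_supergroup G.lower_central_subgroup G.lower_central_normal) simp
  then interpret L: normal ?L ?G4 .
  interpret L': group_hom ?F4 "target r" "leading r" by (rule leading_hom[OF r])
  interpret p: group_hom ?F4 ?G4 ?\<pi>
    by (rule F2.restrict_group_hom[OF G1_hom F2.lower_central_subgroup G.lower_central_subgroup])
       (simp add: G1_lower_central)
  interpret q: group_hom ?G4 "?G4 Mod ?L" "(#>\<^bsub>?G4\<^esub>) ?L" by (rule L.quotient_group_hom)
  let ?h = "\<lambda>g. ?L #>\<^bsub>?G4\<^esub> ?\<pi> g"
  interpret h: group_hom ?F4 "?G4 Mod ?L" ?h
    using hom_compose[OF p.homh q.homh]
    by (intro group_hom.intro group_hom_axioms.intro) (simp_all add: comp_def)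
  have "?h g = \<one>\<^bsub>?G4 Mod ?L\<^esub> \<longleftrightarrow> leading r g = \<one>\<^bsub>target r\<^esub>" if "g \<in> carrier ?F4" for g
    using L.coset_eq_iff_mem[OF p.hom_closed[OF that]] leading_eq_one_iff[OF r] that by simp
  then have ker: "kernel ?F4 (?G4 Mod ?L) ?h = kernel ?F4 (target r) (leading r)"
    unfolding kernel_def by (intro Collect_cong conj_cong refl)
  have car: "carrier ?G4 = ?\<pi> ` lower_central F2 4" by (simp add: G1_lower_central)
  have "?h ` lower_central F2 4 = (#>\<^bsub>?G4\<^esub>) ?L ` ?\<pi> ` lower_central F2 4"
    by (rule image_image[symmetric])
  also have "\<dots> = carrier (?G4 Mod ?L)"
    unfolding car[symmetric] by (rule carrier_FactGroup[symmetric])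
  finally have "?h ` lower_central F2 4 = carrier (?G4 Mod ?L)" .
  then have "?F4 Mod kernel ?F4 (?G4 Mod ?L) ?h \<cong> ?G4 Mod ?L"
    by (intro h.FactGroup_iso) simp
  then have "?F4 Mod kernel ?F4 (target r) (leading r) \<cong> ?G4 Mod ?L" unfolding ker .
  then have "?G4 Mod ?L \<cong> ?F4 Mod kernel ?F4 (target r) (leading r)"
    by (rule group.iso_sym[OF normal.factorgroup_is_group[OF L'.normal_kernel]])
  moreover have "?F4 Mod kernel ?F4 (target r) (leading r) \<cong> target r"
    using leading_surj[OF r] by (intro L'.FactGroup_iso) simp
  ultimately show ?thesis by (rule iso_trans)
qed

text \<open>For \<open>n\<close> up to 3 an equality would lift to the free group, where
  \<open>x\<close>, \<open>cxy\<close> and [cxy, x] refute it by their images. For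
  \<open>n = 4\<close> it would not lift, as the preimage of the fifth term contains R.\<close>

lemma G1_lower_central_Suc_neq:
  assumes r: "r > 0" and n: "1 \<le> n" "n \<le> 4"
  shows "lower_central (G1 r) (Suc n) \<noteq> lower_central (G1 r) n"
proof
  assume eq: "lower_central (G1 r) (Suc n) = lower_central (G1 r) n"
  have F: "g \<in> lower_central F2 (Suc n)" if "g \<in> lower_central F2 n" "n \<le> 3" for g
  proof -
    have "relators r #>\<^bsub>F2\<^esub> g \<in> lower_central (G1 r) (Suc n)"
      using that unfolding eq by (simp add: G1_lower_central)
    then show ?thesis
      using that G1_coset_lower_central_le_4_iff[of g "Suc n"] F2.lower_central_carrier by simp
  qed
  have c2: "cxy \<in> lower_central F2 2"
    using F2.commutator_lower_central[of 1 x y] by (simp add: cxy_def numeral_2_eq_2)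
  have c3: "commutator F2 cxy x \<in> lower_central F2 3"
    using F2.commutator_lower_central[of 2 cxy] c2 by simp
  consider "n = 1" | "n = 2" | "n = 3" | "n = 4" using n by linarith
  then show False
  proof cases
    case 1
    then have "x \<in> lower_central F2 2" using F[of x] by (simp add: numeral_2_eq_2)
    then obtain p where "to_affine x = (1, p)"
      using to_affine_lower_central[of 2 x] by auto
    then have "X = 0" by (simp add: to_affine_x)
    then show False using coeff2_monomials(1) by simp
  next
    case 2
    then have "cxy \<in> lower_central F2 3" using F[of cxy] c2 by simp
    then obtain p where "to_affine cxy = (1, p)" "vanishes 2 p"
      using to_affine_lower_central[of 3 cxy] by auto
    then have "vanishes 2 X" by (simp add: to_affine_commutators)
    then show False using coeff2_monomials(1) by (simp add: vanishes_def)
  next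
    case 3
    then have "commutator F2 cxy x \<in> lower_central F2 4" using F c3 by simp
    then obtain p where "to_affine (commutator F2 cxy x) = (1, p)" "vanishes 3 p"
      using to_affine_lower_central[of 4] by auto
    then have "vanishes 3 (X * X)" by (auto simp: to_affine_commutators)
    then show False using coeff2_monomials(2) by (simp add: vanishes_def)
  next
    case 4
    \<comment> \<open>This value lies in an infinite cyclic factor, so it is nontrivial even when
      \<open>r = 1\<close> and the finite factor collapses.\<close>
    have "(1, 0, 0) \<in> carrier (target r)"
      using r by (simp add: target_def)
    then obtain g where g: "g \<in> lower_central F2 4" "leading r g = (1, 0, 0)"
      using leading_surj[OF r] by (metis imageE)
    then have "relators r #>\<^bsub>F2\<^esub> g \<in> lower_central (G1 r) 5"
      using eq 4 by (simp add: G1_lower_central)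
    then show False using leading_eq_one_iff[OF r g(1)] g(2) by (simp add: target_def)
  qed
qed

theorem theorem4p4:
  fixes r :: nat
  assumes "r > 0"
  shows "inj_on (lower_central (G1 r)) {1..5}
    \<and> G1 r Mod lower_central (G1 r) 4 \<cong> F2 Mod lower_central F2 4
    \<and> (G1 r)\<lparr>carrier := lower_central (G1 r) 4\<rparr> Mod lower_central (G1 r) 5
        \<cong> integer_group \<times>\<times> integer_group \<times>\<times> integer_mod_group r"
proof (intro conjI)
  interpret G: group "G1 r" by (rule group_G1)
  show "inj_on (lower_central (G1 r)) {1..5}"
  proof (rule linorder_inj_onI')
    fix m n :: nat assume mn: "m \<in> {1..5}" "n \<in> {1..5}" "m < n"
    have "lower_central (G1 r) n \<subseteq> lower_central (G1 r) (Suc m)"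
      using mn by (intro G.lower_central_antimono) simp
    also have "\<dots> \<subset> lower_central (G1 r) m"
      using G1_lower_central_Suc_neq[OF assms, of m] G.lower_central_Suc_subset[of m] mn by auto
    finally show "lower_central (G1 r) m \<noteq> lower_central (G1 r) n" by blast
  qed
  show "G1 r Mod lower_central (G1 r) 4 \<cong> F2 Mod lower_central F2 4"
    by (rule G1_lower_central_4_quotient_iso)
  show "(G1 r)\<lparr>carrier := lower_central (G1 r) 4\<rparr> Mod lower_central (G1 r) 5
      \<cong> integer_group \<times>\<times> integer_group \<times>\<times> integer_mod_group r"
    using G1_lower_central_5_quotient_iso[OF assms] by (simp only: target_def)
qed

end
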